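(* Let $\Omega\subset\mathbb{R}^3$ be a bounded domain. If $\mathsf{B}\in W^{1,\infty}(\Omega)^{3\times3}$ and $\det\mathsf{B}=1$ almost everywhere on $\Omega$, then $\mathsf{B}^{-1}\in W^{1,\infty}(\Omega)^{3\times3}$. If, moreover, $\mu_1,\mu_2,\mu_3\in W^{1,\infty}(\Omega)$, then $\mathcal{A}(\mathsf{B})\in W^{1,\infty}(\Omega)^{3\times3}$.
   Context: $\mathsf{B}$ is a $3\times3$-matrix-valued function on $\Omega$, $\mathsf{B}^{-1}$ is its pointwise matrix inverse, and $\mathcal{A}(\mathsf{B})=\mu_1\mathsf{I}+\mu_2\mathsf{B}+\mu_3\mathsf{B}^{-1}$, where $\mathsf{I}$ is the identity matrix and $\mu_1,\mu_2,\mu_3$ are scalar fields on $\Omega$. *)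

theory Defs
  imports "HOL-Analysis.Analysis"
begin

definition partial_deriv :: "'a::euclidean_space \<Rightarrow> ('a \<Rightarrow> real) \<Rightarrow> 'a \<Rightarrow> real" where
  "partial_deriv b f x = frechet_derivative f (at x) b"

text \<open>The class \<open>C^k\<close> on the whole space. The requirement of differentiability matters:
  \<^const>\<open>frechet_derivative\<close> is an unspecified choice where the derivative does not exist.\<close>

primrec k_times_cont_diff :: "nat \<Rightarrow> ('a::euclidean_space \<Rightarrow> real) \<Rightarrow> bool" where
  "k_times_cont_diff 0 f \<longleftrightarrow> continuous_on UNIV f"
| "k_times_cont_diff (Suc k) f \<longleftrightarrow>
     f differentiable_on UNIV \<and> (\<forall>b\<in>Basis. k_times_cont_diff k (partial_deriv b f))"

text \<open>\<open>C_c^\<infinity>(\<Omega>)\<close>; its members are regarded as extended by zero to the whole space.\<close>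

definition test_functions :: "'a::euclidean_space set \<Rightarrow> ('a \<Rightarrow> real) set" where
  "test_functions \<Omega> = {\<phi>. (\<forall>k. k_times_cont_diff k \<phi>) \<and>
     compact (closure {x. \<phi> x \<noteq> 0}) \<and> closure {x. \<phi> x \<noteq> 0} \<subseteq> \<Omega>}"

text \<open>The spaces below consist of functions rather than of classes modulo equality almost
  everywhere. Membership does not depend on the values on a null set or outside \<open>\<Omega>\<close>.\<close>

definition L_infty :: "'a::euclidean_space set \<Rightarrow> ('a \<Rightarrow> real) set" where
  "L_infty \<Omega> = {f. f \<in> borel_measurable (lebesgue_on \<Omega>) \<and>
     (\<exists>C. AE x in lebesgue_on \<Omega>. \<bar>f x\<bar> \<le> C)}"

text \<open>For \<open>f\<close> and \<open>g\<close> in \<^term>\<open>L_infty \<Omega>\<close>, the only case used, both integrands are integrable.\<close>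

definition weak_partial_deriv ::
  "'a::euclidean_space set \<Rightarrow> 'a \<Rightarrow> ('a \<Rightarrow> real) \<Rightarrow> ('a \<Rightarrow> real) \<Rightarrow> bool" where
  "weak_partial_deriv \<Omega> b f g \<longleftrightarrow>
     (\<forall>\<phi>\<in>test_functions \<Omega>.
        (LINT x|lebesgue_on \<Omega>. f x * partial_deriv b \<phi> x) =
        - (LINT x|lebesgue_on \<Omega>. g x * \<phi> x))"

definition W1_infty :: "'a::euclidean_space set \<Rightarrow> ('a \<Rightarrow> real) set" where
  "W1_infty \<Omega> = {f \<in> L_infty \<Omega>. \<forall>b\<in>Basis. \<exists>g\<in>L_infty \<Omega>. weak_partial_deriv \<Omega> b f g}"

definition W1_infty_mat :: "'a::euclidean_space set \<Rightarrow> ('a \<Rightarrow> real^'n^'m) set" where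
  "W1_infty_mat \<Omega> = {B. \<forall>i j. (\<lambda>x. B x $ i $ j) \<in> W1_infty \<Omega>}"

definition A_op :: "('a \<Rightarrow> real) \<Rightarrow> ('a \<Rightarrow> real) \<Rightarrow> ('a \<Rightarrow> real) \<Rightarrow>
    ('a \<Rightarrow> real^3^3) \<Rightarrow> 'a \<Rightarrow> real^3^3" where
  "A_op \<mu>\<^sub>1 \<mu>\<^sub>2 \<mu>\<^sub>3 B x =
     \<mu>\<^sub>1 x *\<^sub>R mat 1 + \<mu>\<^sub>2 x *\<^sub>R B x + \<mu>\<^sub>3 x *\<^sub>R matrix_inv (B x)"

end

theory Submission
  imports Defs
begin

text \<open>
  Where \<open>det B = 1\<close>, Cramer's rule expresses each entry of the inverse as a determinant whose
  entries are entries of \<open>B\<close> or constants, that is, as a polynomial in the entries of \<open>B\<close>. So the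
  theorem holds because \<open>W1_infty \<Omega>\<close> is an algebra that contains the constants, and the only
  substantial point is the product rule (\<open>weak_deriv_lborel_mult\<close>): if \<open>F\<close> and \<open>G\<close> are bounded with
  bounded weak derivatives \<open>F'\<close> and \<open>G'\<close> in direction \<open>b\<close>, then \<open>F G\<close> has the weak derivative
  \<open>F G' + F' G\<close>.

  The usual proof mollifies one factor. Here difference quotients are used instead. For a test
  function \<open>\<phi>\<close>, the integral of \<open>F G\<close> times the partial derivative of \<open>\<phi>\<close> is the limit of the integrals
  of \<open>F(x) G(x) (\<phi>(x + t b) - \<phi>(x)) / t\<close>, and translation invariance moves the difference onto
  \<open>F G\<close>, where it splits into \<open>F D G + G D F + (D F) (D G)\<close> with
  \<open>D F(x) = F(x - t b) - F(x)\<close>. Two facts about a single function \<open>F\<close> are needed, in both of which \<open>q\<close>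
  is an arbitrary bounded Borel function:
  the integral of \<open>D F\<close> against \<open>\<phi> q\<close> is at most \<open>sup \<bar>F'\<bar>\<close> times \<open>\<bar>t\<bar>\<close> times the integral of
  \<open>\<bar>\<phi> q\<bar>\<close> (\<open>difference_pairing_bound\<close>), and its quotient by \<open>t\<close> tends to minus the integral of \<open>F'\<close>
  against \<open>\<phi> q\<close> (\<open>difference_quotient_weak_limit\<close>).
  If \<open>q\<close> is a polynomial, then \<open>\<phi> q\<close> is itself a test function and both facts follow from the
  definition of the weak derivative by differentiating along the translation. The general case
  follows because polynomials are dense in \<open>L\<^sup>1\<close> with weight \<open>\<bar>\<phi>\<bar>\<close> (\<open>polynomials_dense_weighted_L1\<close>).
\<close>

section \<open>Smooth functions and test functions\<close>

lemma partial_deriv_along_line: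
  assumes "f differentiable_on UNIV"
  shows "((\<lambda>s. f (x + s *\<^sub>R b)) has_field_derivative partial_deriv b f (x + t *\<^sub>R b)) (at t)"
proof -
  have "(f has_derivative frechet_derivative f (at (x + t *\<^sub>R b))) (at (x + t *\<^sub>R b))"
    using assms by (simp add: frechet_derivative_works differentiable_on_def)
  moreover have "((\<lambda>s. x + s *\<^sub>R b) has_derivative (\<lambda>s. s *\<^sub>R b)) (at t)"
    by (auto intro!: derivative_eq_intros)
  ultimately have "((\<lambda>s. f (x + s *\<^sub>R b)) has_derivative
      (\<lambda>s. frechet_derivative f (at (x + t *\<^sub>R b)) (s *\<^sub>R b))) (at t)"
    using has_derivative_compose by fastforce
  moreover have "frechet_derivative f (at (x + t *\<^sub>R b)) (s *\<^sub>R b)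
      = partial_deriv b f (x + t *\<^sub>R b) * s" for s
    using assms linear_frechet_derivative[of f "at (x + t *\<^sub>R b)"]
    by (simp add: linear_scale differentiable_on_def partial_deriv_def)
  ultimately show ?thesis
    by (simp add: has_field_derivative_def)
qed

lemma partial_deriv_eqI:
  assumes "(f has_derivative f') (at x)"
  shows "partial_deriv b f x = f' b"
  using frechet_derivative_at[OF assms] by (simp add: partial_deriv_def)

lemma partial_deriv_add:
  assumes "f differentiable_on UNIV" "g differentiable_on UNIV"
  shows "partial_deriv b (\<lambda>x. f x + g x) = (\<lambda>x. partial_deriv b f x + partial_deriv b g x)"
proof
  fix x
  have "((\<lambda>x. f x + g x) has_derivative
      (\<lambda>h. frechet_derivative f (at x) h + frechet_derivative g (at x) h)) (at x)"
    using assms by (intro has_derivative_add) (simp_all add: frechet_derivative_works differentiable_on_def)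
  from partial_deriv_eqI[OF this]
  show "partial_deriv b (\<lambda>x. f x + g x) x = partial_deriv b f x + partial_deriv b g x"
    by (simp add: partial_deriv_def)
qed

lemma partial_deriv_mult:
  assumes "f differentiable_on UNIV" "g differentiable_on UNIV"
  shows "partial_deriv b (\<lambda>x. f x * g x) = (\<lambda>x. f x * partial_deriv b g x + partial_deriv b f x * g x)"
proof
  fix x
  have "((\<lambda>x. f x * g x) has_derivative
      (\<lambda>h. f x * frechet_derivative g (at x) h + frechet_derivative f (at x) h * g x)) (at x)"
    using assms by (intro has_derivative_mult) (simp_all add: frechet_derivative_works differentiable_on_def)
  from partial_deriv_eqI[OF this]
  show "partial_deriv b (\<lambda>x. f x * g x) x = f x * partial_deriv b g x + partial_deriv b f x * g x"
    by (simp add: partial_deriv_def)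
qed

lemma partial_deriv_shift:
  assumes "f differentiable_on UNIV"
  shows "partial_deriv b (\<lambda>x. f (x + c)) = (\<lambda>x. partial_deriv b f (x + c))"
proof
  fix x
  have "(f has_derivative frechet_derivative f (at (x + c))) (at (x + c))"
    using assms by (simp add: frechet_derivative_works differentiable_on_def)
  moreover have "((\<lambda>x. x + c) has_derivative (\<lambda>h. h)) (at x)"
    by (auto intro!: derivative_eq_intros)
  ultimately have "((\<lambda>x. f (x + c)) has_derivative frechet_derivative f (at (x + c))) (at x)"
    using has_derivative_compose by fastforce
  from partial_deriv_eqI[OF this]
  show "partial_deriv b (\<lambda>x. f (x + c)) x = partial_deriv b f (x + c)"
    by (simp add: partial_deriv_def)
qed

lemma k_times_cont_diff_SucD: "k_times_cont_diff (Suc k) f \<Longrightarrow> k_times_cont_diff k f"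
proof (induction k arbitrary: f)
  case 0
  then show ?case by (simp add: differentiable_imp_continuous_on)
next
  case (Suc k)
  then show ?case by auto
qed

lemma k_times_cont_diff_add:
  "k_times_cont_diff k f \<Longrightarrow> k_times_cont_diff k g \<Longrightarrow> k_times_cont_diff k (\<lambda>x. f x + g x)"
proof (induction k arbitrary: f g)
  case 0
  then show ?case by (auto intro: continuous_intros)
next
  case (Suc k)
  then show ?case by (simp add: partial_deriv_add differentiable_on_add)
qed

lemma k_times_cont_diff_mult:
  "k_times_cont_diff k f \<Longrightarrow> k_times_cont_diff k g \<Longrightarrow> k_times_cont_diff k (\<lambda>x. f x * g x)"
proof (induction k arbitrary: f g)
  case 0
  then show ?case by (auto intro: continuous_intros)
next
  case (Suc k)
  then have "k_times_cont_diff k f" "k_times_cont_diff k g"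
    by (blast intro: k_times_cont_diff_SucD)+
  with Suc show ?case
    by (simp add: partial_deriv_mult differentiable_on_mult k_times_cont_diff_add)
qed

lemma k_times_cont_diff_const: "k_times_cont_diff k (\<lambda>x. c)"
proof (induction k arbitrary: c)
  case (Suc k)
  have "partial_deriv b (\<lambda>x::'a. c) = (\<lambda>x. 0)" for b
    by (auto intro!: ext partial_deriv_eqI[where f'="\<lambda>_. 0"])
  with Suc show ?case by simp
qed simp

lemma k_times_cont_diff_bounded_linear:
  assumes "bounded_linear f"
  shows "k_times_cont_diff k f"
proof (cases k)
  case 0
  with assms show ?thesis by (simp add: linear_continuous_on)
next
  case (Suc j)
  have "partial_deriv b f = (\<lambda>x. f b)" for b
    using assms by (auto intro!: ext partial_deriv_eqI bounded_linear_imp_has_derivative)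
  with Suc assms show ?thesis
    by (simp add: k_times_cont_diff_const bounded_linear_imp_differentiable_on)
qed

lemma k_times_cont_diff_polynomial:
  "real_polynomial_function p \<Longrightarrow> k_times_cont_diff k p"
  by (induction p rule: real_polynomial_function.induct)
    (auto intro: k_times_cont_diff_add k_times_cont_diff_mult k_times_cont_diff_const
      k_times_cont_diff_bounded_linear)

lemma k_times_cont_diff_shift:
  "k_times_cont_diff k f \<Longrightarrow> k_times_cont_diff k (\<lambda>x. f (x + c))"
proof (induction k arbitrary: f)
  case 0
  then show ?case
    by (auto intro!: continuous_on_compose2[of UNIV f] continuous_intros)
next
  case (Suc k)
  have "(\<lambda>x. f (x + c)) differentiable_on UNIV"
    unfolding differentiable_on_def
  proof
    fix x
    have "f differentiable at (x + c)"
      using Suc.prems by (simp add: differentiable_on_def)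
    then show "(\<lambda>x. f (x + c)) differentiable at x"
      by (intro differentiable_compose[of f "\<lambda>x. x + c"]) auto
  qed
  with Suc show ?case by (simp add: partial_deriv_shift)
qed

lemma test_functionD:
  assumes "\<phi> \<in> test_functions \<Omega>" "b \<in> Basis"
  shows "\<phi> differentiable_on UNIV" "continuous_on UNIV \<phi>" "continuous_on UNIV (partial_deriv b \<phi>)"
proof -
  have "k_times_cont_diff (Suc 0) \<phi>"
    using assms unfolding test_functions_def by blast
  then show "\<phi> differentiable_on UNIV" "continuous_on UNIV (partial_deriv b \<phi>)"
    using assms(2) by auto
  then show "continuous_on UNIV \<phi>"
    by (simp add: differentiable_imp_continuous_on)
qed

text \<open>The complement of the closed support is open, so that \<open>\<phi>\<close> is locally constant there.\<close>

lemma partial_deriv_eq_0_outside_support: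
  assumes "x \<notin> closure {x. \<phi> x \<noteq> 0}"
  shows "partial_deriv b \<phi> x = 0"
proof -
  have "(\<phi> has_derivative (\<lambda>_. 0)) (at x)"
  proof (rule has_derivative_transform_within_open)
    show "((\<lambda>_. 0) has_derivative (\<lambda>_. 0)) (at x)"
      by (rule has_derivative_const)
    show "open (- closure {x. \<phi> x \<noteq> 0})" "x \<in> - closure {x. \<phi> x \<noteq> 0}"
      using assms by auto
    show "0 = \<phi> y" if "y \<in> - closure {x. \<phi> x \<noteq> 0}" for y
      using that closure_subset[of "{x. \<phi> x \<noteq> 0}"] by auto
  qed
  then show ?thesis by (rule partial_deriv_eqI)
qed

text \<open>A given test function brings its compact support along. Multiplying it by polynomials
  therefore supplies enough test functions for a density argument, and no bump function has to be
  constructed.\<close>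

lemma test_function_mult_polynomial:
  assumes "\<phi> \<in> test_functions \<Omega>" "real_polynomial_function p"
  shows "(\<lambda>x. \<phi> x * p x) \<in> test_functions \<Omega>"
proof -
  have sub: "closure {x. \<phi> x * p x \<noteq> 0} \<subseteq> closure {x. \<phi> x \<noteq> 0}"
    by (intro closure_mono) auto
  moreover have "compact (closure {x. \<phi> x * p x \<noteq> 0})"
    using assms(1) compact_closure by (auto simp: test_functions_def intro: bounded_subset[of "{x. \<phi> x \<noteq> 0}"])
  ultimately show ?thesis
    using assms k_times_cont_diff_polynomial[OF assms(2)]
    by (auto simp: test_functions_def intro: k_times_cont_diff_mult)
qed

lemma test_function_shift:
  assumes "\<phi> \<in> test_functions \<Omega>" "\<And>x. x \<in> closure {x. \<phi> x \<noteq> 0} \<Longrightarrow> x - c \<in> \<Omega>"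
  shows "(\<lambda>x. \<phi> (x + c)) \<in> test_functions \<Omega>"
proof -
  let ?K = "closure {x. \<phi> x \<noteq> 0}"
  have "{x. \<phi> (x + c) \<noteq> 0} = (\<lambda>x. x - c) ` {x. \<phi> x \<noteq> 0}"
    by (force simp: image_iff intro: exI[of _ "_ + c"])
  then have eq: "closure {x. \<phi> (x + c) \<noteq> 0} = (\<lambda>x. x - c) ` ?K"
    using closure_translation[of "- c" "{x. \<phi> x \<noteq> 0}"] by simp
  have "compact ((\<lambda>x. x - c) ` ?K)"
    using assms(1) by (intro compact_continuous_image continuous_intros) (simp add: test_functions_def)
  with assms eq show ?thesis
    by (auto simp del: compact_closure simp: test_functions_def intro: k_times_cont_diff_shift)
qed

section \<open>Bounded Borel functions against continuous functions of compact support\<close>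

definition bounded_borel :: "('a::euclidean_space \<Rightarrow> real) \<Rightarrow> bool" where
  "bounded_borel F \<longleftrightarrow> F \<in> borel_measurable borel \<and> (\<exists>C. \<forall>x. \<bar>F x\<bar> \<le> C)"

text \<open>The class \<open>C_c\<close>. It contains the test functions and their partial derivatives, and it is
  what a bounded Borel function can be integrated against.\<close>

definition Cc :: "('a::euclidean_space \<Rightarrow> real) set" where
  "Cc = {\<psi>. continuous_on UNIV \<psi> \<and> compact (closure {x. \<psi> x \<noteq> 0})}"

lemma bounded_borel_measurable: "bounded_borel F \<Longrightarrow> F \<in> borel_measurable borel"
  by (simp add: bounded_borel_def)

lemma bounded_borel_bound:
  assumes "bounded_borel F"
  shows "\<exists>C\<ge>0. \<forall>x. \<bar>F x\<bar> \<le> C"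
proof -
  obtain C where "\<forall>x. \<bar>F x\<bar> \<le> C"
    using assms by (auto simp: bounded_borel_def)
  moreover from this have "0 \<le> C"
    by (meson abs_ge_zero order_trans)
  ultimately show ?thesis by blast
qed

lemma bounded_borelI:
  "F \<in> borel_measurable borel \<Longrightarrow> (\<And>x. \<bar>F x\<bar> \<le> C) \<Longrightarrow> bounded_borel F"
  by (auto simp: bounded_borel_def)

lemma bounded_borel_const: "bounded_borel (\<lambda>x. c)"
  by (rule bounded_borelI[of _ "\<bar>c\<bar>"]) auto

lemma bounded_borel_add:
  assumes "bounded_borel F" "bounded_borel G"
  shows "bounded_borel (\<lambda>x. F x + G x)"
proof -
  obtain C where "C \<ge> 0" and C: "\<And>x. \<bar>F x\<bar> \<le> C"
    using bounded_borel_bound[OF assms(1)] by blast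
  obtain D where D: "\<And>x. \<bar>G x\<bar> \<le> D"
    using bounded_borel_bound[OF assms(2)] by blast
  have "\<bar>F x + G x\<bar> \<le> C + D" for x
    using C[of x] D[of x] by linarith
  then show ?thesis
    by (rule bounded_borelI[rotated]) (intro borel_measurable_add bounded_borel_measurable assms)
qed

lemma bounded_borel_mult:
  assumes "bounded_borel F" "bounded_borel G"
  shows "bounded_borel (\<lambda>x. F x * G x)"
proof -
  obtain C where C: "C \<ge> 0" "\<And>x. \<bar>F x\<bar> \<le> C"
    using bounded_borel_bound[OF assms(1)] by blast
  obtain D where D: "\<And>x. \<bar>G x\<bar> \<le> D"
    using bounded_borel_bound[OF assms(2)] by blast
  have "\<bar>F x * G x\<bar> \<le> C * D" for x
    unfolding abs_mult using C D by (intro mult_mono) auto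
  then show ?thesis
    by (rule bounded_borelI[rotated]) (intro borel_measurable_times bounded_borel_measurable assms)
qed

lemma bounded_borel_diff:
  assumes "bounded_borel F" "bounded_borel G"
  shows "bounded_borel (\<lambda>x. F x - G x)"
  using bounded_borel_add[OF assms(1) bounded_borel_mult[OF bounded_borel_const[of "-1"] assms(2)]]
  by simp

lemma bounded_borel_shift:
  assumes "bounded_borel F"
  shows "bounded_borel (\<lambda>x. F (x + c))"
proof -
  have [measurable]: "F \<in> borel_measurable borel"
    using assms by (rule bounded_borel_measurable)
  have "(\<lambda>x. F (x + c)) \<in> borel_measurable borel"
    by measurable
  with assms show ?thesis
    unfolding bounded_borel_def by blast
qed

lemma Cc_bounded_borel:
  assumes "\<psi> \<in> Cc"
  shows "bounded_borel \<psi>"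
proof -
  let ?K = "closure {x. \<psi> x \<noteq> 0}"
  have "continuous_on UNIV \<psi>" "compact ?K"
    using assms by (auto simp: Cc_def)
  then have "bounded (\<psi> ` ?K)"
    by (meson compact_continuous_image compact_imp_bounded continuous_on_subset top_greatest)
  then obtain M where M: "\<And>x. x \<in> ?K \<Longrightarrow> \<bar>\<psi> x\<bar> \<le> M"
    by (auto simp: bounded_iff)
  have "\<bar>\<psi> x\<bar> \<le> max M 0" for x
    using M[of x] closure_subset[of "{x. \<psi> x \<noteq> 0}"] by (cases "\<psi> x = 0") auto
  then show ?thesis
    using \<open>continuous_on UNIV \<psi>\<close> by (intro bounded_borelI) (auto intro: borel_measurable_continuous_onI)
qed

lemma Cc_mult_continuous:
  assumes "\<psi> \<in> Cc" "continuous_on UNIV f"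
  shows "(\<lambda>x. \<psi> x * f x) \<in> Cc"
proof -
  have "bounded {x. \<psi> x * f x \<noteq> 0}"
    using assms(1) compact_closure by (auto simp: Cc_def intro: bounded_subset[of "{x. \<psi> x \<noteq> 0}"])
  with assms show ?thesis
    by (auto simp: Cc_def compact_closure intro: continuous_intros)
qed

lemma Cc_integrable:
  assumes "bounded_borel F" "\<psi> \<in> Cc"
  shows "integrable lborel (\<lambda>x. F x * \<psi> x)"
proof -
  let ?K = "closure {x. \<psi> x \<noteq> 0}"
  have "bounded_borel (\<lambda>x. F x * \<psi> x)"
    by (rule bounded_borel_mult[OF assms(1) Cc_bounded_borel[OF assms(2)]])
  then obtain C where C: "\<And>x. \<bar>F x * \<psi> x\<bar> \<le> C" and meas: "(\<lambda>x. F x * \<psi> x) \<in> borel_measurable borel"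
    by (auto simp: bounded_borel_def)
  have "compact ?K"
    using assms by (simp add: Cc_def)
  then have "emeasure lborel ?K < \<infinity>"
    by (intro emeasure_compact_finite)
  then have int: "integrable lborel (\<lambda>x. C * indicator ?K x)"
    by (intro integrable_mult_right integrable_real_indicator) auto
  have le: "norm (F x * \<psi> x) \<le> norm (C * indicator ?K x)" for x
    using C[of x] closure_subset[of "{x. \<psi> x \<noteq> 0}"] by (auto simp: indicator_def)
  show ?thesis
    by (rule Bochner_Integration.integrable_bound[OF int _ AE_I2[OF le]]) (simp add: meas)
qed

lemma Cc_integrable_abs:
  assumes "bounded_borel F" "\<psi> \<in> Cc"
  shows "integrable lborel (\<lambda>x. \<bar>\<psi> x\<bar> * \<bar>F x\<bar>)"
  using integrable_abs[OF Cc_integrable[OF assms]] by (simp add: abs_mult mult.commute)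

lemma test_function_Cc:
  assumes "\<phi> \<in> test_functions \<Omega>"
  shows "\<phi> \<in> Cc" and "b \<in> Basis \<Longrightarrow> partial_deriv b \<phi> \<in> Cc"
proof -
  show "\<phi> \<in> Cc"
    using assms by (auto simp: test_functions_def Cc_def dest: spec[of _ 0])
  assume b: "b \<in> Basis"
  have "{x. partial_deriv b \<phi> x \<noteq> 0} \<subseteq> closure {x. \<phi> x \<noteq> 0}"
    using partial_deriv_eq_0_outside_support by blast
  moreover have "compact (closure {x. \<phi> x \<noteq> 0})"
    using assms by (simp add: test_functions_def)
  ultimately have "bounded {x. partial_deriv b \<phi> x \<noteq> 0}"
    by (meson bounded_subset compact_imp_bounded)
  with test_functionD[OF assms b] show "partial_deriv b \<phi> \<in> Cc"
    by (simp add: Cc_def compact_closure)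
qed

lemma lborel_integral_shift:
  fixes f :: "'a::euclidean_space \<Rightarrow> real"
  assumes [measurable]: "f \<in> borel_measurable borel"
  shows "(LINT x|lborel. f (x + c)) = (LINT x|lborel. f x)"
proof -
  have "(LINT x|lborel. f x) = (LINT x|distr lborel borel ((+) c). f x)"
    by (simp add: lborel_distr_plus)
  also have "\<dots> = (LINT x|lborel. f (x + c))"
    by (subst integral_distr) (auto simp: add.commute)
  finally show ?thesis by simp
qed

text \<open>Polynomials are dense in \<open>L\<^sup>1\<close> with weight \<open>\<bar>\<psi>\<bar>\<close>: a measurable \<open>q\<close> is almost everywhere a limit of
  continuous functions, which may be truncated to the bounds of \<open>q\<close>; on the compact support of
  \<open>\<psi>\<close> each of them is uniformly close to a polynomial by the Stone--Weierstrass theorem; and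
  dominated convergence applies because of the truncation.\<close>

lemma polynomials_dense_weighted_L1:
  assumes "\<psi> \<in> Cc" "bounded_borel q"
  obtains p where "\<And>n. real_polynomial_function (p n)"
    "(\<lambda>n. LINT x|lborel. \<bar>\<psi> x\<bar> * \<bar>q x - p n x\<bar>) \<longlonglongrightarrow> 0"
proof -
  let ?K = "closure {x. \<psi> x \<noteq> 0}"
  have K: "compact ?K" and zero: "\<And>x. x \<notin> ?K \<Longrightarrow> \<psi> x = 0"
    using assms closure_subset[of "{x. \<psi> x \<noteq> 0}"] by (auto simp: Cc_def)
  obtain C where C: "C \<ge> 0" "\<And>x. \<bar>q x\<bar> \<le> C"
    using bounded_borel_bound[OF assms(2)] by blast
  have "q measurable_on UNIV"
    using assms(2) by (intro lebesgue_measurable_imp_measurable_on)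
      (auto simp: bounded_borel_def measurable_completion)
  then obtain N g where N: "negligible N" and g: "\<And>n. continuous_on UNIV (g n :: 'a \<Rightarrow> real)"
    and lim: "\<And>x. x \<notin> N \<Longrightarrow> (\<lambda>n. g n x) \<longlonglongrightarrow> q x"
    unfolding measurable_on_def by auto
  define h where "h n x = max (- C) (min C (g n x))" for n x
  have h_bound: "\<bar>h n x\<bar> \<le> C" for n x
    using C(1) by (auto simp: h_def)
  have "\<exists>p. real_polynomial_function p \<and> (\<forall>x\<in>?K. \<bar>h n x - p x\<bar> < inverse (Suc n))" for n
  proof -
    have "continuous_on ?K (h n)"
      unfolding h_def by (intro continuous_intros continuous_on_subset[OF g subset_UNIV])
    then obtain p where "real_polynomial_function p" "\<And>x. x \<in> ?K \<Longrightarrow> \<bar>h n x - p x\<bar> < inverse (Suc n)"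
      by (rule Stone_Weierstrass_real_polynomial_function[OF K, of "h n" "inverse (Suc n)"]) auto
    then show ?thesis by blast
  qed
  then obtain p where p: "\<And>n. real_polynomial_function (p n)"
    and close: "\<And>n x. x \<in> ?K \<Longrightarrow> \<bar>h n x - p n x\<bar> < inverse (Suc n)"
    by metis
  have "(\<lambda>n. LINT x|lborel. \<bar>\<psi> x\<bar> * \<bar>q x - p n x\<bar>) \<longlonglongrightarrow> (LINT x|(lborel :: 'a measure). (0::real))"
  proof (rule integral_dominated_convergence)
    have [measurable]: "q \<in> borel_measurable borel" "\<psi> \<in> borel_measurable borel"
      using assms Cc_bounded_borel by (auto intro: bounded_borel_measurable)
    have [measurable]: "p n \<in> borel_measurable borel" for n
      using p[of n] by (intro borel_measurable_continuous_onI continuous_on_polymonial_function)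
        (simp add: real_polynomial_function_eq)
    show "(\<lambda>x. \<bar>\<psi> x\<bar> * \<bar>q x - p n x\<bar>) \<in> borel_measurable lborel" for n
      by measurable
    show "integrable lborel (\<lambda>x. \<bar>\<psi> x\<bar> * \<bar>2 * C + 1\<bar>)"
      using assms(1) by (intro Cc_integrable_abs bounded_borel_const)
    show "AE x in lborel. norm (\<bar>\<psi> x\<bar> * \<bar>q x - p n x\<bar>) \<le> \<bar>\<psi> x\<bar> * \<bar>2 * C + 1\<bar>" for n
    proof (rule AE_I2)
      fix x
      have "\<bar>q x - p n x\<bar> \<le> \<bar>2 * C + 1\<bar>" if "x \<in> ?K"
      proof -
        have "inverse (real (Suc n)) \<le> 1"
          by (simp add: inverse_le_1_iff)
        with close[OF that, of n] h_bound[of n x] C(2)[of x] show ?thesis by linarith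
      qed
      then show "norm (\<bar>\<psi> x\<bar> * \<bar>q x - p n x\<bar>) \<le> \<bar>\<psi> x\<bar> * \<bar>2 * C + 1\<bar>"
        using zero[of x] by (cases "x \<in> ?K") (auto simp: abs_mult mult_left_mono)
    qed
    have "(\<lambda>n. \<bar>\<psi> x\<bar> * \<bar>q x - p n x\<bar>) \<longlonglongrightarrow> 0" if "x \<notin> N" for x
    proof (cases "x \<in> ?K")
      case True
      have "(\<lambda>n. h n x) \<longlonglongrightarrow> max (- C) (min C (q x))"
        unfolding h_def using lim[OF that] by (intro tendsto_intros)
      also have "max (- C) (min C (q x)) = q x"
        using C(2)[of x] by auto
      finally have "(\<lambda>n. h n x) \<longlonglongrightarrow> q x" .
      moreover have "(\<lambda>n. h n x - p n x) \<longlonglongrightarrow> 0"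
      proof (rule Lim_null_comparison[OF _ LIMSEQ_inverse_real_of_nat])
        show "\<forall>\<^sub>F n in sequentially. norm (h n x - p n x) \<le> inverse (Suc n)"
          using less_imp_le[OF close[OF True]] by (intro always_eventually allI) simp
      qed
      ultimately have "(\<lambda>n. h n x - (h n x - p n x)) \<longlonglongrightarrow> q x - 0"
        by (intro tendsto_diff)
      then have "(\<lambda>n. \<bar>\<psi> x\<bar> * \<bar>q x - p n x\<bar>) \<longlonglongrightarrow> \<bar>\<psi> x\<bar> * \<bar>q x - q x\<bar>"
        by (intro tendsto_intros) simp
      then show ?thesis by simp
    next
      case False
      then have "\<psi> x = 0" by (rule zero)
      then show ?thesis by simp
    qed
    moreover have "AE x in lborel. x \<notin> N"
      using AE_not_in[of N lebesgue] N by (simp add: negligible_iff_null_sets AE_completion_iff)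
    ultimately show "AE x in lborel. (\<lambda>n. \<bar>\<psi> x\<bar> * \<bar>q x - p n x\<bar>) \<longlonglongrightarrow> 0"
      by auto
  qed auto
  then show thesis
    by (intro that[of p] p) simp
qed

text \<open>Difference quotients of a test function converge pointwise, are bounded by the supremum of the
  derivative, and live in a fixed ball while \<open>\<bar>t\<bar> \<le> 1\<close>; hence dominated convergence.\<close>

lemma difference_quotient_tendsto_partial_deriv:
  assumes \<phi>: "\<phi> \<in> test_functions \<Omega>" and b: "b \<in> Basis" and F: "bounded_borel F"
  shows "((\<lambda>t. LINT x|lborel. F x * ((\<phi> (x + t *\<^sub>R b) - \<phi> x) / t)) \<longlongrightarrow>
    (LINT x|lborel. F x * partial_deriv b \<phi> x)) (at 0)"
proof -
  let ?q = "\<lambda>t x. (\<phi> (x + t *\<^sub>R b) - \<phi> x) / t"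
  have deriv: "((\<lambda>s. \<phi> (x + s *\<^sub>R b)) has_field_derivative partial_deriv b \<phi> (x + t *\<^sub>R b)) (at t)" for x t
    using \<phi> b by (intro partial_deriv_along_line test_functionD)
  obtain L where L: "\<And>x. \<bar>partial_deriv b \<phi> x\<bar> \<le> L"
    using bounded_borel_bound[OF Cc_bounded_borel[OF test_function_Cc(2)[OF \<phi> b]]]
    by blast
  have lip: "\<bar>?q t x\<bar> \<le> L" for t x
  proof -
    have "norm (\<phi> (x + t *\<^sub>R b) - \<phi> (x + 0 *\<^sub>R b)) \<le> L * norm (t - 0)"
      by (rule field_differentiable_bound[of UNIV])
        (use deriv L in \<open>auto intro: DERIV_subset\<close>)
    then show ?thesis
      using L[of x] by (cases "t = 0") (auto simp: field_simps abs_mult)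
  qed
  obtain R where R: "\<And>x. \<phi> x \<noteq> 0 \<Longrightarrow> norm x \<le> R"
    using \<phi> compact_closure by (auto simp: test_functions_def bounded_iff)
  have outside: "?q t x = 0" if "x \<notin> cball 0 (R + 1)" "\<bar>t\<bar> \<le> 1" for t x
  proof -
    have "norm x \<le> norm (x + t *\<^sub>R b) + norm (t *\<^sub>R b)"
      using norm_triangle_ineq4[of "x + t *\<^sub>R b" "t *\<^sub>R b"] by simp
    moreover have "norm (t *\<^sub>R b) \<le> 1"
      using that b by simp
    ultimately have "\<phi> (x + t *\<^sub>R b) = 0" "\<phi> x = 0"
      using R[of x] R[of "x + t *\<^sub>R b"] that by force+
    then show ?thesis by simp
  qed
  obtain C where C: "C \<ge> 0" "\<And>x. \<bar>F x\<bar> \<le> C"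
    using bounded_borel_bound[OF F] by blast
  have [measurable]: "F \<in> borel_measurable borel" "\<phi> \<in> borel_measurable borel"
      "partial_deriv b \<phi> \<in> borel_measurable borel"
    using F test_function_Cc[OF \<phi>] b Cc_bounded_borel by (auto intro: bounded_borel_measurable)
  \<comment> \<open>The restriction to \<open>{-1..1}\<close> makes the dominating function valid for every term of
    a sequence, and it does not change the filter at \<open>0\<close>.\<close>
  have "((\<lambda>t. LINT x|lborel. F x * ?q t x) \<longlongrightarrow>
      (LINT x|lborel. F x * partial_deriv b \<phi> x)) (at 0 within {-1..1})"
    unfolding tendsto_at_iff_sequentially o_def
  proof (intro allI impI)
    fix X :: "nat \<Rightarrow> real"
    assume X: "\<forall>i. X i \<in> {-1..1} - {0}" "X \<longlonglongrightarrow> 0"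
    show "(\<lambda>i. LINT x|lborel. F x * ?q (X i) x) \<longlonglongrightarrow> (LINT x|lborel. F x * partial_deriv b \<phi> x)"
    proof (rule integral_dominated_convergence)
      show "(\<lambda>x. F x * partial_deriv b \<phi> x) \<in> borel_measurable lborel"
        by measurable
      show "(\<lambda>x. F x * ?q (X i) x) \<in> borel_measurable lborel" for i
        by measurable
      show "integrable lborel (\<lambda>x. C * L * indicator (cball 0 (R + 1)) x)"
        using emeasure_compact_finite[OF compact_cball] by (intro integrable_mult_right integrable_real_indicator) auto
      show "AE x in lborel. norm (F x * ?q (X i) x) \<le> C * L * indicator (cball 0 (R + 1)) x" for i
      proof (rule AE_I2)
        fix x
        have "\<bar>F x\<bar> * \<bar>?q (X i) x\<bar> \<le> C * L"
          using C lip by (intro mult_mono) auto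
        moreover have "\<bar>X i\<bar> \<le> 1" using X(1) by (auto dest: spec[of _ i])
        ultimately show "norm (F x * ?q (X i) x) \<le> C * L * indicator (cball 0 (R + 1)) x"
          using outside[of x "X i"] by (cases "x \<in> cball 0 (R + 1)") (auto simp: abs_mult)
      qed
      show "AE x in lborel. (\<lambda>i. F x * ?q (X i) x) \<longlonglongrightarrow> F x * partial_deriv b \<phi> x"
      proof (intro AE_I2 tendsto_mult tendsto_const)
        fix x
        have "((\<lambda>t. ?q t x) \<longlongrightarrow> partial_deriv b \<phi> x) (at 0)"
          using deriv[of x 0] by (simp add: DERIV_def)
        then show "(\<lambda>i. ?q (X i) x) \<longlonglongrightarrow> partial_deriv b \<phi> x"
          unfolding tendsto_at_iff_sequentially o_def using X by auto
      qed
    qed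
  qed
  moreover have "at (0::real) within {-1..1} = at 0"
    by (rule at_within_interior) (simp add: interior_atLeastAtMost_real)
  ultimately show ?thesis by simp
qed

lemma polynomial_continuous_on:
  "real_polynomial_function p \<Longrightarrow> continuous_on S p"
  by (simp add: continuous_on_polymonial_function real_polynomial_function_eq)

text \<open>A polynomial need not be bounded. Cut off to the support of a weight \<open>\<phi>\<close> it is, and its product
  with \<open>\<phi>\<close> does not change.\<close>

lemma bounded_borel_cutoff:
  assumes "compact K" "continuous_on UNIV p"
  shows "bounded_borel (\<lambda>x. indicator K x * p x)"
proof -
  have "bounded (p ` K)"
    using assms by (meson compact_continuous_image compact_imp_bounded continuous_on_subset subset_UNIV)
  then obtain M where M: "\<And>x. x \<in> K \<Longrightarrow> \<bar>p x\<bar> \<le> M"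
    by (auto simp: bounded_iff)
  have "\<bar>indicator K x * p x\<bar> \<le> max M 0" for x
    using M[of x] by (cases "x \<in> K") auto
  moreover have "(\<lambda>x. indicator K x * p x) \<in> borel_measurable borel"
    using assms by (intro borel_measurable_times borel_measurable_indicator borel_compact)
      (auto intro: borel_measurable_continuous_onI)
  ultimately show ?thesis by (intro bounded_borelI)
qed

lemma bounded_borel_sign:
  assumes [measurable]: "u \<in> borel_measurable borel"
  shows "\<exists>s. bounded_borel s \<and> (\<forall>x. s x * u x = \<bar>u x\<bar>) \<and> (\<forall>x. \<bar>s x\<bar> = (1::real))"
proof (intro exI conjI allI)
  let ?s = "\<lambda>x. if u x \<ge> 0 then 1 else - 1 :: real"
  show "bounded_borel ?s"
  proof (rule bounded_borelI)
    show "?s \<in> borel_measurable borel"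
      by measurable
    show "\<bar>?s x\<bar> \<le> 1" for x
      by simp
  qed
qed auto

lemma weighted_error_integrable:
  assumes "\<psi> \<in> Cc" "bounded_borel q" "continuous_on UNIV p"
  shows "integrable lborel (\<lambda>x. \<bar>\<psi> x\<bar> * \<bar>q x - p x\<bar>)"
proof -
  have "integrable lborel (\<lambda>x. \<bar>q x * \<psi> x - 1 * (\<psi> x * p x)\<bar>)"
    by (intro integrable_abs Bochner_Integration.integrable_diff Cc_integrable
        bounded_borel_const Cc_mult_continuous assms)
  moreover have "\<bar>q x * \<psi> x - 1 * (\<psi> x * p x)\<bar> = \<bar>\<psi> x\<bar> * \<bar>q x - p x\<bar>" for x
    by (simp add: algebra_simps flip: abs_mult)
  ultimately show ?thesis by simp
qed

text \<open>Together with the density of polynomials, this extends what is known for test functions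
  \<open>\<psi> p\<close> with a polynomial \<open>p\<close> to all products \<open>\<psi> q\<close> with \<open>q\<close> bounded and Borel.\<close>

lemma pairing_approximation_error:
  assumes G: "bounded_borel G" "\<And>x. \<bar>G x\<bar> \<le> C"
    and \<psi>: "\<psi> \<in> Cc" and q: "bounded_borel q" and p: "continuous_on UNIV p"
  shows "\<bar>(LINT x|lborel. G x * (\<psi> x * q x)) - (LINT x|lborel. G x * (\<psi> x * p x))\<bar>
    \<le> C * (LINT x|lborel. \<bar>\<psi> x\<bar> * \<bar>q x - p x\<bar>)"
proof -
  have int1: "integrable lborel (\<lambda>x. G x * (\<psi> x * q x))"
    using Cc_integrable[OF bounded_borel_mult[OF G(1) q] \<psi>] by (simp only: mult_ac)
  have int2: "integrable lborel (\<lambda>x. G x * (\<psi> x * p x))"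
    by (intro Cc_integrable G(1) Cc_mult_continuous \<psi> p)
  note int = Bochner_Integration.integrable_diff[OF int1 int2]
  have "\<bar>(LINT x|lborel. G x * (\<psi> x * q x)) - (LINT x|lborel. G x * (\<psi> x * p x))\<bar>
      = \<bar>LINT x|lborel. G x * (\<psi> x * q x) - G x * (\<psi> x * p x)\<bar>"
    using int1 int2 by simp
  also have "\<dots> \<le> (LINT x|lborel. \<bar>G x * (\<psi> x * q x) - G x * (\<psi> x * p x)\<bar>)"
    by (rule integral_abs_bound)
  also have "\<dots> \<le> (LINT x|lborel. C * (\<bar>\<psi> x\<bar> * \<bar>q x - p x\<bar>))"
  proof (rule integral_mono)
    show "integrable lborel (\<lambda>x. \<bar>G x * (\<psi> x * q x) - G x * (\<psi> x * p x)\<bar>)"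
      by (intro integrable_abs int)
    show "integrable lborel (\<lambda>x. C * (\<bar>\<psi> x\<bar> * \<bar>q x - p x\<bar>))"
      by (intro integrable_mult_right weighted_error_integrable \<psi> q p)
    fix x
    have "\<bar>G x * (\<psi> x * q x) - G x * (\<psi> x * p x)\<bar> = \<bar>G x\<bar> * (\<bar>\<psi> x\<bar> * \<bar>q x - p x\<bar>)"
      by (simp add: algebra_simps flip: abs_mult)
    also have "\<dots> \<le> C * (\<bar>\<psi> x\<bar> * \<bar>q x - p x\<bar>)"
      by (intro mult_right_mono G(2)) simp
    finally show "\<bar>G x * (\<psi> x * q x) - G x * (\<psi> x * p x)\<bar> \<le> C * (\<bar>\<psi> x\<bar> * \<bar>q x - p x\<bar>)" .
  qed
  finally show ?thesis by simp
qed

lemma weighted_norm_approximation_error: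
  assumes \<psi>: "\<psi> \<in> Cc" and q: "bounded_borel q" and p: "continuous_on UNIV p"
  shows "(LINT x|lborel. \<bar>\<psi> x * p x\<bar>)
    \<le> (LINT x|lborel. \<bar>\<psi> x\<bar> * \<bar>q x\<bar>) + (LINT x|lborel. \<bar>\<psi> x\<bar> * \<bar>q x - p x\<bar>)"
proof -
  have int: "integrable lborel (\<lambda>x. \<bar>\<psi> x\<bar> * \<bar>q x\<bar>)" "integrable lborel (\<lambda>x. \<bar>\<psi> x\<bar> * \<bar>q x - p x\<bar>)"
    by (intro Cc_integrable_abs weighted_error_integrable \<psi> q p)+
  have "(LINT x|lborel. \<bar>\<psi> x * p x\<bar>) \<le> (LINT x|lborel. \<bar>\<psi> x\<bar> * \<bar>q x\<bar> + \<bar>\<psi> x\<bar> * \<bar>q x - p x\<bar>)"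
  proof (rule integral_mono)
    show "integrable lborel (\<lambda>x. \<bar>\<psi> x * p x\<bar>)"
      using Cc_integrable_abs[OF bounded_borel_const[of 1] Cc_mult_continuous[OF \<psi> p]] by simp
    show "integrable lborel (\<lambda>x. \<bar>\<psi> x\<bar> * \<bar>q x\<bar> + \<bar>\<psi> x\<bar> * \<bar>q x - p x\<bar>)"
      using int by (rule Bochner_Integration.integrable_add)
    fix x
    have "\<bar>\<psi> x\<bar> * \<bar>p x\<bar> \<le> \<bar>\<psi> x\<bar> * (\<bar>q x\<bar> + \<bar>q x - p x\<bar>)"
      by (intro mult_left_mono) auto
    then show "\<bar>\<psi> x * p x\<bar> \<le> \<bar>\<psi> x\<bar> * \<bar>q x\<bar> + \<bar>\<psi> x\<bar> * \<bar>q x - p x\<bar>"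
      by (simp add: abs_mult distrib_left)
  qed
  with int show ?thesis by simp
qed

section \<open>The product rule for weak derivatives\<close>

text \<open>The weak derivative for representatives that are Borel and bounded at every point of the
  whole space. As test functions vanish outside \<open>\<Omega>\<close>, the integrals can be taken over all of it, where
  Lebesgue measure is translation invariant.\<close>

definition weak_deriv_lborel ::
  "'a::euclidean_space set \<Rightarrow> 'a \<Rightarrow> ('a \<Rightarrow> real) \<Rightarrow> ('a \<Rightarrow> real) \<Rightarrow> bool" where
  "weak_deriv_lborel \<Omega> b F F' \<longleftrightarrow> bounded_borel F \<and> bounded_borel F' \<and>
     (\<forall>\<phi>\<in>test_functions \<Omega>.
        (LINT x|lborel. F x * partial_deriv b \<phi> x) = - (LINT x|lborel. F' x * \<phi> x))"

text \<open>The discrete form of integration by parts, by translation invariance of Lebesgue measure.\<close>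

lemma integral_difference_quotient_shift:
  assumes F: "bounded_borel F" and \<psi>: "\<psi> \<in> Cc" "(\<lambda>x. \<psi> (x + c)) \<in> Cc"
  shows "(LINT x|lborel. F x * (\<psi> (x + c) - \<psi> x)) = (LINT x|lborel. (F (x - c) - F x) * \<psi> x)"
proof -
  have "bounded_borel (\<lambda>x. F (x - c))"
    using bounded_borel_shift[OF F, of "- c"] by simp
  note int = Cc_integrable[OF F \<psi>(1)] Cc_integrable[OF F \<psi>(2)] Cc_integrable[OF this \<psi>(1)]
  have "(\<lambda>x. F (x - c) * \<psi> x) \<in> borel_measurable borel"
    using int(3) by (simp add: borel_measurable_integrable flip: measurable_lborel1)
  from lborel_integral_shift[OF this, of c]
  have "(LINT x|lborel. F x * \<psi> (x + c)) = (LINT x|lborel. F (x - c) * \<psi> x)"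
    by simp
  with int show ?thesis
    by (simp add: algebra_simps)
qed

text \<open>With the support of a test function as \<open>K\<close>, this says how far it may be translated and remain
  a test function on \<open>\<Omega>\<close>; the product rule uses openness of \<open>\<Omega>\<close> here.\<close>

lemma compact_support_room:
  fixes b :: "'a::euclidean_space"
  assumes "compact K" "open \<Omega>" "K \<subseteq> \<Omega>" "b \<in> Basis"
  obtains \<delta> where "\<delta> > 0" "\<And>s x. \<bar>s\<bar> < \<delta> \<Longrightarrow> x \<in> K \<Longrightarrow> x - s *\<^sub>R b \<in> \<Omega>"
proof -
  obtain \<delta> where \<delta>: "\<delta> > 0" "(\<Union>x\<in>K. ball x \<delta>) \<subseteq> \<Omega>"
    using assms(1-3) by (rule compact_subset_open_imp_ball_epsilon_subset)
  have "x - s *\<^sub>R b \<in> \<Omega>" if "\<bar>s\<bar> < \<delta>" "x \<in> K" for s x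
  proof -
    have "x - s *\<^sub>R b \<in> ball x \<delta>"
      using that assms(4) by (simp add: dist_norm)
    with \<delta>(2) that(2) show ?thesis by blast
  qed
  with \<delta>(1) show thesis by (rule that)
qed

text \<open>A bounded weak derivative gives a Lipschitz bound in the weak sense. With
  \<open>I s = \<integral> F(x) \<phi>(x + s b) dx\<close> the integral is \<open>I t - I 0\<close>, and differentiating under the integral
  sign gives \<open>I' s = - \<integral> F'(x) \<phi>(x + s b) dx\<close>, since the translate of \<open>\<phi>\<close> is again a test
  function; \<open>\<bar>I' s\<bar>\<close> is at most \<open>M\<close> times the integral of \<open>\<bar>\<phi>\<bar>\<close> whenever \<open>\<bar>s\<bar> < \<delta>\<close>.\<close>

lemma difference_pairing_bound_test_function:
  assumes b: "b \<in> Basis" and weak: "weak_deriv_lborel \<Omega> b F F'"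
    and M: "\<And>x. \<bar>F' x\<bar> \<le> M"
    and \<phi>: "\<phi> \<in> test_functions \<Omega>"
    and room: "\<And>s x. \<bar>s\<bar> < \<delta> \<Longrightarrow> x \<in> closure {x. \<phi> x \<noteq> 0} \<Longrightarrow> x - s *\<^sub>R b \<in> \<Omega>"
    and t: "\<bar>t\<bar> < \<delta>"
  shows "\<bar>LINT x|lborel. (F (x - t *\<^sub>R b) - F x) * \<phi> x\<bar> \<le> M * \<bar>t\<bar> * (LINT x|lborel. \<bar>\<phi> x\<bar>)"
proof -
  have bb: "bounded_borel F" "bounded_borel F'"
    using weak by (auto simp: weak_deriv_lborel_def)
  define I where "I s = (LINT x|lborel. F x * \<phi> (x + s *\<^sub>R b))" for s
  define J where "J s = - (LINT x|lborel. F' x * \<phi> (x + s *\<^sub>R b))" for s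
  have shifted: "(\<lambda>x. \<phi> (x + s *\<^sub>R b)) \<in> test_functions \<Omega>" if "\<bar>s\<bar> < \<delta>" for s
    using \<phi> room[OF that] by (rule test_function_shift)
  note Cc = test_function_Cc(1)[OF shifted]
  have I': "(I has_field_derivative J s) (at s)" if s: "\<bar>s\<bar> < \<delta>" for s
    unfolding DERIV_def
  proof (rule Lim_transform_eventually)
    show "((\<lambda>h. LINT x|lborel. F x * ((\<phi> (x + h *\<^sub>R b + s *\<^sub>R b) - \<phi> (x + s *\<^sub>R b)) / h)) \<longlongrightarrow> J s) (at 0)"
      using difference_quotient_tendsto_partial_deriv[OF shifted[OF s] b bb(1)]
        weak shifted[OF s] by (simp add: weak_deriv_lborel_def J_def)
    have "((\<lambda>h. \<bar>s + h\<bar>) \<longlongrightarrow> \<bar>s + 0\<bar>) (at 0)"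
      by (intro tendsto_intros)
    then have "\<forall>\<^sub>F h in at 0. \<bar>s + h\<bar> < \<delta>"
      by (rule order_tendstoD(2)) (use s in simp)
    then show "\<forall>\<^sub>F h in at 0. (LINT x|lborel. F x * ((\<phi> (x + h *\<^sub>R b + s *\<^sub>R b) - \<phi> (x + s *\<^sub>R b)) / h))
        = (I (s + h) - I s) / h"
    proof eventually_elim
      case (elim h)
      with s have int: "integrable lborel (\<lambda>x. F x * \<phi> (x + (s + h) *\<^sub>R b))"
          "integrable lborel (\<lambda>x. F x * \<phi> (x + s *\<^sub>R b))"
        by (auto intro: Cc_integrable[OF bb(1) Cc])
      have "x + h *\<^sub>R b + s *\<^sub>R b = x + (s + h) *\<^sub>R b" for x
        by (simp add: algebra_simps)
      then have "(LINT x|lborel. F x * ((\<phi> (x + h *\<^sub>R b + s *\<^sub>R b) - \<phi> (x + s *\<^sub>R b)) / h))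
          = (LINT x|lborel. (F x * \<phi> (x + (s + h) *\<^sub>R b) - F x * \<phi> (x + s *\<^sub>R b)) / h)"
        by (simp only: right_diff_distrib times_divide_eq_right)
      also have "\<dots> = (I (s + h) - I s) / h"
        using int by (simp add: I_def)
      finally show ?case .
    qed
  qed
  have J: "\<bar>J s\<bar> \<le> M * (LINT x|lborel. \<bar>\<phi> x\<bar>)" if s: "\<bar>s\<bar> < \<delta>" for s
  proof -
    have "\<bar>J s\<bar> \<le> (LINT x|lborel. \<bar>F' x * \<phi> (x + s *\<^sub>R b)\<bar>)"
      unfolding J_def abs_minus_cancel by (rule integral_abs_bound)
    also have "\<dots> \<le> (LINT x|lborel. M * \<bar>\<phi> (x + s *\<^sub>R b)\<bar>)"
    proof (rule integral_mono)
      show "integrable lborel (\<lambda>x. \<bar>F' x * \<phi> (x + s *\<^sub>R b)\<bar>)"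
        by (intro integrable_abs Cc_integrable bb Cc s)
      show "integrable lborel (\<lambda>x. M * \<bar>\<phi> (x + s *\<^sub>R b)\<bar>)"
        using Cc_integrable_abs[OF bounded_borel_const[of 1] Cc[OF s]] by simp
      show "\<bar>F' x * \<phi> (x + s *\<^sub>R b)\<bar> \<le> M * \<bar>\<phi> (x + s *\<^sub>R b)\<bar>" for x
        unfolding abs_mult by (intro mult_right_mono M) simp
    qed
    also have "\<dots> = M * (LINT x|lborel. \<bar>\<phi> x\<bar>)"
    proof -
      have [measurable]: "\<phi> \<in> borel_measurable borel"
        by (intro bounded_borel_measurable Cc_bounded_borel test_function_Cc[OF \<phi>])
      show ?thesis
        using lborel_integral_shift[of "\<lambda>x. \<bar>\<phi> x\<bar>" "s *\<^sub>R b"] by simp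
    qed
    finally show ?thesis .
  qed
  have "norm (I t - I 0) \<le> M * (LINT x|lborel. \<bar>\<phi> x\<bar>) * norm (t - 0)"
  proof (rule field_differentiable_bound[of "{-\<bar>t\<bar>..\<bar>t\<bar>}"])
    have small: "\<bar>s\<bar> < \<delta>" if "s \<in> {-\<bar>t\<bar>..\<bar>t\<bar>}" for s
      using that t unfolding atLeastAtMost_iff by linarith
    show "(I has_field_derivative J s) (at s within {-\<bar>t\<bar>..\<bar>t\<bar>})" if "s \<in> {-\<bar>t\<bar>..\<bar>t\<bar>}" for s
      by (rule has_field_derivative_at_within[OF I'[OF small[OF that]]])
    show "norm (J s) \<le> M * (LINT x|lborel. \<bar>\<phi> x\<bar>)" if "s \<in> {-\<bar>t\<bar>..\<bar>t\<bar>}" for s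
      unfolding real_norm_def by (rule J[OF small[OF that]])
    show "t \<in> {-\<bar>t\<bar>..\<bar>t\<bar>}"
      unfolding atLeastAtMost_iff by linarith
  qed simp_all
  moreover have "I t - I 0 = (LINT x|lborel. F x * (\<phi> (x + t *\<^sub>R b) - \<phi> x))"
    using Cc_integrable[OF bb(1) Cc[OF t]] Cc_integrable[OF bb(1) test_function_Cc(1)[OF \<phi>]]
    by (simp add: I_def right_diff_distrib)
  ultimately show ?thesis
    using integral_difference_quotient_shift[OF bb(1) test_function_Cc(1)[OF \<phi>] Cc[OF t]]
    by (simp add: mult_ac)
qed

context
  fixes \<Omega> :: "'a::euclidean_space set" and b :: 'a and F F' :: "'a \<Rightarrow> real" and M \<delta> :: real
    and \<phi> :: "'a \<Rightarrow> real"
  assumes b: "b \<in> Basis" and weak: "weak_deriv_lborel \<Omega> b F F'"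
    and M: "\<And>x. \<bar>F' x\<bar> \<le> M"
    and \<phi>: "\<phi> \<in> test_functions \<Omega>"
    and room: "\<And>s x. \<bar>s\<bar> < \<delta> \<Longrightarrow> x \<in> closure {x. \<phi> x \<noteq> 0} \<Longrightarrow> x - s *\<^sub>R b \<in> \<Omega>"
begin

private lemma bb: "bounded_borel F" "bounded_borel F'"
  using weak by (auto simp: weak_deriv_lborel_def)

private lemma bb_diff: "bounded_borel (\<lambda>x. F (x - t *\<^sub>R b) - F x)"
  using bounded_borel_diff[OF bounded_borel_shift[OF bb(1), of "- t *\<^sub>R b"] bb(1)] by simp

private lemma M_nonneg: "0 \<le> M"
  by (rule order_trans[OF abs_ge_zero M])

private lemma room_polynomial:
  assumes "\<bar>s\<bar> < \<delta>" "x \<in> closure {x. \<phi> x * p x \<noteq> 0}"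
  shows "x - s *\<^sub>R b \<in> \<Omega>"
proof -
  have "closure {x. \<phi> x * p x \<noteq> 0} \<subseteq> closure {x. \<phi> x \<noteq> 0}"
    by (intro closure_mono) auto
  with assms room show ?thesis by blast
qed

text \<open>The same bound with a factor \<open>q\<close> of no regularity, by approximation: for a polynomial \<open>p\<close> in
  place of \<open>q\<close> the product \<open>\<phi> p\<close> is a test function, and both sides are continuous in the weighted
  \<open>L\<^sup>1\<close> norm.\<close>

lemma difference_pairing_bound:
  assumes t: "\<bar>t\<bar> < \<delta>" and q: "bounded_borel q"
  shows "\<bar>LINT x|lborel. (F (x - t *\<^sub>R b) - F x) * (\<phi> x * q x)\<bar>
    \<le> M * \<bar>t\<bar> * (LINT x|lborel. \<bar>\<phi> x\<bar> * \<bar>q x\<bar>)"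
proof -
  let ?D = "\<lambda>x. F (x - t *\<^sub>R b) - F x"
  obtain C where C: "\<And>x. \<bar>?D x\<bar> \<le> C"
    using bounded_borel_bound[OF bb_diff] by blast
  have Cc: "\<phi> \<in> Cc"
    using \<phi> by (rule test_function_Cc)
  obtain p where p: "\<And>n. real_polynomial_function (p n)"
    and lim: "(\<lambda>n. LINT x|lborel. \<bar>\<phi> x\<bar> * \<bar>q x - p n x\<bar>) \<longlonglongrightarrow> 0"
    using polynomials_dense_weighted_L1[OF Cc q] by blast
  define E where "E n = (LINT x|lborel. \<bar>\<phi> x\<bar> * \<bar>q x - p n x\<bar>)" for n
  have "\<bar>LINT x|lborel. ?D x * (\<phi> x * q x)\<bar>
      \<le> M * \<bar>t\<bar> * ((LINT x|lborel. \<bar>\<phi> x\<bar> * \<bar>q x\<bar>) + E n) + C * E n" for n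
  proof -
    have "\<bar>LINT x|lborel. ?D x * (\<phi> x * p n x)\<bar> \<le> M * \<bar>t\<bar> * (LINT x|lborel. \<bar>\<phi> x * p n x\<bar>)"
      by (rule difference_pairing_bound_test_function[OF b weak M
            test_function_mult_polynomial[OF \<phi> p] room_polynomial t])
    also have "\<dots> \<le> M * \<bar>t\<bar> * ((LINT x|lborel. \<bar>\<phi> x\<bar> * \<bar>q x\<bar>) + E n)"
      unfolding E_def
      by (intro mult_left_mono weighted_norm_approximation_error Cc q polynomial_continuous_on p
          mult_nonneg_nonneg M_nonneg abs_ge_zero)
    finally show ?thesis
      using pairing_approximation_error[OF bb_diff C Cc q polynomial_continuous_on[OF p[of n]]]
      unfolding E_def by linarith
  qed
  moreover have "(\<lambda>n. M * \<bar>t\<bar> * ((LINT x|lborel. \<bar>\<phi> x\<bar> * \<bar>q x\<bar>) + E n) + C * E n)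
      \<longlonglongrightarrow> M * \<bar>t\<bar> * ((LINT x|lborel. \<bar>\<phi> x\<bar> * \<bar>q x\<bar>) + 0) + C * 0"
    using lim unfolding E_def by (intro tendsto_intros)
  ultimately show ?thesis
    using LIMSEQ_le_const by fastforce
qed

text \<open>The difference quotients of \<open>F\<close> converge weakly to \<open>- F'\<close>, also against \<open>\<phi> q\<close> with merely
  bounded Borel \<open>q\<close>. For a polynomial this is the definition of the weak derivative; the error of
  replacing \<open>q\<close> by a polynomial is controlled uniformly in \<open>t\<close> by the previous bound.\<close>

lemma difference_quotient_weak_limit:
  assumes \<delta>: "\<delta> > 0" and q: "bounded_borel q"
  shows "((\<lambda>t. (LINT x|lborel. (F (x - t *\<^sub>R b) - F x) * (\<phi> x * q x)) / t) \<longlongrightarrow>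
    - (LINT x|lborel. F' x * (\<phi> x * q x))) (at 0)"
proof (rule tendstoI)
  fix e :: real
  assume e: "e > 0"
  let ?K = "closure {x. \<phi> x \<noteq> 0}"
  let ?A = "\<lambda>t q. LINT x|lborel. (F (x - t *\<^sub>R b) - F x) * (\<phi> x * q x)"
  have Cc: "\<phi> \<in> Cc"
    using \<phi> by (rule test_function_Cc)
  obtain p where p: "\<And>n. real_polynomial_function (p n)"
    and lim: "(\<lambda>n. LINT x|lborel. \<bar>\<phi> x\<bar> * \<bar>q x - p n x\<bar>) \<longlonglongrightarrow> 0"
    using polynomials_dense_weighted_L1[OF Cc q] by blast
  have "(\<lambda>n. M * (LINT x|lborel. \<bar>\<phi> x\<bar> * \<bar>q x - p n x\<bar>)) \<longlonglongrightarrow> M * 0"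
    by (intro tendsto_intros lim)
  then have "\<forall>\<^sub>F n in sequentially. M * (LINT x|lborel. \<bar>\<phi> x\<bar> * \<bar>q x - p n x\<bar>) < e / 3"
    by (rule order_tendstoD(2)) (use e in simp)
  then obtain n where n: "M * (LINT x|lborel. \<bar>\<phi> x\<bar> * \<bar>q x - p n x\<bar>) < e / 3"
    by (auto simp: eventually_sequentially)
  have cont: "continuous_on UNIV (p n)"
    using p by (rule polynomial_continuous_on)
  have test: "(\<lambda>x. \<phi> x * p n x) \<in> test_functions \<Omega>"
    by (rule test_function_mult_polynomial[OF \<phi> p])
  have small: "\<forall>\<^sub>F t in at 0. \<bar>t\<bar> < \<delta>"
    using \<delta> by (auto simp: eventually_at dist_real_def)
  have "((\<lambda>t. ?A t (p n) / t) \<longlongrightarrow> - (LINT x|lborel. F' x * (\<phi> x * p n x))) (at 0)"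
  proof (rule Lim_transform_eventually)
    show "((\<lambda>t. LINT x|lborel. F x * ((\<phi> (x + t *\<^sub>R b) * p n (x + t *\<^sub>R b) - \<phi> x * p n x) / t)) \<longlongrightarrow>
        - (LINT x|lborel. F' x * (\<phi> x * p n x))) (at 0)"
      using difference_quotient_tendsto_partial_deriv[OF test b bb(1)] weak test
      by (simp add: weak_deriv_lborel_def)
    show "\<forall>\<^sub>F t in at 0.
        (LINT x|lborel. F x * ((\<phi> (x + t *\<^sub>R b) * p n (x + t *\<^sub>R b) - \<phi> x * p n x) / t)) = ?A t (p n) / t"
      using small
    proof eventually_elim
      case (elim t)
      have "(\<lambda>x. \<phi> (x + t *\<^sub>R b) * p n (x + t *\<^sub>R b)) \<in> Cc"
        by (rule test_function_Cc(1)[OF test_function_shift[OF test room_polynomial[OF elim]]])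
      from integral_difference_quotient_shift[OF bb(1) test_function_Cc(1)[OF test] this]
      show ?case by simp
    qed
  qed
  then have "\<forall>\<^sub>F t in at 0. dist (?A t (p n) / t) (- (LINT x|lborel. F' x * (\<phi> x * p n x))) < e / 3"
    by (rule tendstoD) (use e in simp)
  moreover have "\<forall>\<^sub>F t in at (0::real). t \<noteq> 0"
    by (simp add: eventually_at_filter)
  ultimately show "\<forall>\<^sub>F t in at 0. dist (?A t q / t) (- (LINT x|lborel. F' x * (\<phi> x * q x))) < e"
    using small
  proof eventually_elim
    case (elim t)
    \<comment> \<open>The error \<open>q - p n\<close>, with \<open>p n\<close> cut off to be bounded, which leaves its product with \<open>\<phi>\<close> as it is.\<close>
    let ?r = "\<lambda>x. q x - indicator ?K x * p n x"
    have r: "bounded_borel ?r"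
      using \<phi> cont by (intro bounded_borel_diff bounded_borel_cutoff q) (simp_all add: test_functions_def)
    have r_eq: "\<phi> x * ?r x = \<phi> x * q x - \<phi> x * p n x" for x
      using closure_subset[of "{x. \<phi> x \<noteq> 0}"] by (cases "\<phi> x = 0") (auto simp: right_diff_distrib)
    have "?A t ?r = ?A t q - ?A t (p n)"
    proof -
      have "integrable lborel (\<lambda>x. (F (x - t *\<^sub>R b) - F x) * (\<phi> x * q x))"
        using Cc_integrable[OF bounded_borel_mult[OF bb_diff q] Cc] by (simp only: mult_ac)
      moreover have "integrable lborel (\<lambda>x. (F (x - t *\<^sub>R b) - F x) * (\<phi> x * p n x))"
        by (intro Cc_integrable bb_diff Cc_mult_continuous Cc cont)
      ultimately show ?thesis
        unfolding r_eq by (subst right_diff_distrib) (rule Bochner_Integration.integral_diff)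
    qed
    moreover have "\<bar>\<phi> x\<bar> * \<bar>?r x\<bar> = \<bar>\<phi> x\<bar> * \<bar>q x - p n x\<bar>" for x
      by (simp only: r_eq abs_mult[symmetric]) (simp only: right_diff_distrib)
    ultimately have "\<bar>?A t q - ?A t (p n)\<bar> \<le> M * \<bar>t\<bar> * (LINT x|lborel. \<bar>\<phi> x\<bar> * \<bar>q x - p n x\<bar>)"
      using difference_pairing_bound[OF elim(3) r] by (simp only:)
    then have "\<bar>?A t q - ?A t (p n)\<bar> / \<bar>t\<bar> \<le> M * (LINT x|lborel. \<bar>\<phi> x\<bar> * \<bar>q x - p n x\<bar>)"
      using elim(2) by (simp add: divide_le_eq mult_ac)
    then have "\<bar>?A t q / t - ?A t (p n) / t\<bar> < e / 3"
      using n by (simp add: diff_divide_distrib flip: abs_divide)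
    moreover have "\<bar>(LINT x|lborel. F' x * (\<phi> x * q x)) - (LINT x|lborel. F' x * (\<phi> x * p n x))\<bar> < e / 3"
      using pairing_approximation_error[OF bb(2) M Cc q cont] n by linarith
    ultimately show ?case
      using elim(1) unfolding dist_real_def by linarith
  qed
qed

end

text \<open>The product rule. With \<open>D\<close> for the difference of a translate and the function itself,
  \<open>D(F G) = F D G + G D F + (D F) (D G)\<close>. After division by \<open>t\<close> the first two terms have the weak limits
  provided by the preceding lemma, with \<open>F\<close> and \<open>G\<close> in the role of the factor \<open>q\<close>. The last term is of
  order \<open>t\<^sup>2\<close> before the division.\<close>

theorem weak_deriv_lborel_mult:
  assumes b: "b \<in> Basis" and "open \<Omega>"
    and F: "weak_deriv_lborel \<Omega> b F F'" and G: "weak_deriv_lborel \<Omega> b G G'"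
  shows "weak_deriv_lborel \<Omega> b (\<lambda>x. F x * G x) (\<lambda>x. F x * G' x + F' x * G x)"
proof -
  have bb: "bounded_borel F" "bounded_borel F'" "bounded_borel G" "bounded_borel G'"
    using F G by (auto simp: weak_deriv_lborel_def)
  note bFG = bounded_borel_mult[OF bb(1,3)]
  obtain M where M: "\<And>x. \<bar>F' x\<bar> \<le> M"
    using bounded_borel_bound[OF bb(2)] by blast
  obtain N where N: "\<And>x. \<bar>G' x\<bar> \<le> N"
    using bounded_borel_bound[OF bb(4)] by blast
  have MN: "M \<ge> 0" "N \<ge> 0"
    by (rule order_trans[OF abs_ge_zero M], rule order_trans[OF abs_ge_zero N])
  have bd: "bounded_borel (\<lambda>x. H (x - t *\<^sub>R b) - H x)" if "bounded_borel H" for H t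
    using bounded_borel_diff[OF bounded_borel_shift[OF that, of "- t *\<^sub>R b"] that] by simp
  have "(LINT x|lborel. F x * G x * partial_deriv b \<phi> x)
      = - (LINT x|lborel. (F x * G' x + F' x * G x) * \<phi> x)" if \<phi>: "\<phi> \<in> test_functions \<Omega>" for \<phi>
  proof -
    have Cc: "\<phi> \<in> Cc"
      using \<phi> by (rule test_function_Cc)
    have "compact (closure {x. \<phi> x \<noteq> 0})" "closure {x. \<phi> x \<noteq> 0} \<subseteq> \<Omega>"
      using \<phi> by (simp_all add: test_functions_def)
    then obtain \<delta> where \<delta>: "\<delta> > 0"
      and room: "\<And>s x. \<bar>s\<bar> < \<delta> \<Longrightarrow> x \<in> closure {x. \<phi> x \<noteq> 0} \<Longrightarrow> x - s *\<^sub>R b \<in> \<Omega>"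
      using compact_support_room[OF _ \<open>open \<Omega>\<close> _ b] by blast
    let ?DF = "\<lambda>t x. F (x - t *\<^sub>R b) - F x" and ?DG = "\<lambda>t x. G (x - t *\<^sub>R b) - G x"
    let ?n = "LINT x|lborel. \<bar>\<phi> x\<bar>"
    have small: "\<forall>\<^sub>F t in at 0. \<bar>t\<bar> < \<delta>"
      using \<delta> by (auto simp: eventually_at dist_real_def)
    \<comment> \<open>Apply the pairing bound to \<open>F\<close> with \<open>q = D G\<close>, and then to \<open>G\<close> with the sign that turns
      the pairing into the integral of \<open>\<bar>\<phi> D G\<bar>\<close>.\<close>
    have rem: "\<bar>(LINT x|lborel. ?DF t x * (\<phi> x * ?DG t x)) / t\<bar> \<le> M * N * ?n * \<bar>t\<bar>"
      if t: "\<bar>t\<bar> < \<delta>" for t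
    proof -
      have "(\<lambda>x. \<phi> x * ?DG t x) \<in> borel_measurable borel"
        by (intro bounded_borel_measurable bounded_borel_mult Cc_bounded_borel[OF Cc] bd bb)
      from bounded_borel_sign[OF this] obtain s where s: "bounded_borel s"
        and sign: "\<And>x. s x * (\<phi> x * ?DG t x) = \<bar>\<phi> x * ?DG t x\<bar>" "\<And>x. \<bar>s x\<bar> = 1"
        by blast
      have "?DG t x * (\<phi> x * s x) = \<bar>\<phi> x\<bar> * \<bar>?DG t x\<bar>" for x
        using sign(1)[of x] by (simp only: abs_mult mult_ac)
      moreover have "\<bar>\<phi> x\<bar> * \<bar>s x\<bar> = \<bar>\<phi> x\<bar>" for x
        by (simp add: sign(2))
      ultimately have *: "\<bar>LINT x|lborel. \<bar>\<phi> x\<bar> * \<bar>?DG t x\<bar>\<bar> \<le> N * \<bar>t\<bar> * ?n"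
        using difference_pairing_bound[OF b G N \<phi> room t s] by (simp only:)
      have "\<bar>LINT x|lborel. ?DF t x * (\<phi> x * ?DG t x)\<bar> \<le> M * \<bar>t\<bar> * (LINT x|lborel. \<bar>\<phi> x\<bar> * \<bar>?DG t x\<bar>)"
        by (rule difference_pairing_bound[OF b F M \<phi> room t bd[OF bb(3)]])
      also have "\<dots> \<le> M * \<bar>t\<bar> * (N * \<bar>t\<bar> * ?n)"
        using * MN by (intro mult_left_mono) auto
      finally show ?thesis
        by (cases "t = 0") (simp_all add: abs_divide divide_le_eq mult_ac)
    qed
    have "((\<lambda>t. (LINT x|lborel. ?DF t x * (\<phi> x * ?DG t x)) / t) \<longlongrightarrow> 0) (at 0)"
    proof (rule Lim_null_comparison)
      show "\<forall>\<^sub>F t in at 0. norm ((LINT x|lborel. ?DF t x * (\<phi> x * ?DG t x)) / t) \<le> M * N * ?n * \<bar>t\<bar>"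
        using small by eventually_elim (use rem in simp)
      show "((\<lambda>t. M * N * ?n * \<bar>t\<bar>) \<longlongrightarrow> 0) (at (0::real))"
        by (auto intro!: tendsto_eq_intros)
    qed
    note lims = tendsto_add[OF tendsto_add[OF
          difference_quotient_weak_limit[OF b G N \<phi> room \<delta> bb(1)]
          difference_quotient_weak_limit[OF b F M \<phi> room \<delta> bb(3)]] this]
    have lim: "((\<lambda>t. LINT x|lborel. F x * G x * ((\<phi> (x + t *\<^sub>R b) - \<phi> x) / t)) \<longlongrightarrow>
        - (LINT x|lborel. G' x * (\<phi> x * F x)) + - (LINT x|lborel. F' x * (\<phi> x * G x)) + 0) (at 0)"
    proof (rule Lim_transform_eventually[OF lims])
      show "\<forall>\<^sub>F t in at 0. (LINT x|lborel. ?DG t x * (\<phi> x * F x)) / t + (LINT x|lborel. ?DF t x * (\<phi> x * G x)) / t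
          + (LINT x|lborel. ?DF t x * (\<phi> x * ?DG t x)) / t
          = (LINT x|lborel. F x * G x * ((\<phi> (x + t *\<^sub>R b) - \<phi> x) / t))"
        using small
      proof eventually_elim
        case (elim t)
        have Cc': "(\<lambda>x. \<phi> (x + t *\<^sub>R b)) \<in> Cc"
          by (rule test_function_Cc(1)[OF test_function_shift[OF \<phi> room[OF elim]]])
        have int: "integrable lborel (\<lambda>x. H x * (\<phi> x * K x))" if "bounded_borel H" "bounded_borel K" for H K
          using Cc_integrable[OF bounded_borel_mult[OF that] Cc] by (simp only: mult_ac)
        have "(LINT x|lborel. F x * G x * (\<phi> (x + t *\<^sub>R b) - \<phi> x))
            = (LINT x|lborel. (F (x - t *\<^sub>R b) * G (x - t *\<^sub>R b) - F x * G x) * \<phi> x)"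
          by (rule integral_difference_quotient_shift[OF bFG Cc Cc'])
        also have "\<dots> = (LINT x|lborel. ?DG t x * (\<phi> x * F x) + ?DF t x * (\<phi> x * G x) + ?DF t x * (\<phi> x * ?DG t x))"
          by (intro Bochner_Integration.integral_cong) (simp_all add: algebra_simps)
        also have "\<dots> = (LINT x|lborel. ?DG t x * (\<phi> x * F x)) + (LINT x|lborel. ?DF t x * (\<phi> x * G x))
            + (LINT x|lborel. ?DF t x * (\<phi> x * ?DG t x))"
          by (simp only: Bochner_Integration.integral_add Bochner_Integration.integrable_add int bd bb)
        finally show ?case
          by (simp add: add_divide_distrib)
      qed
    qed
    have "(LINT x|lborel. F x * G x * partial_deriv b \<phi> x)
        = - (LINT x|lborel. G' x * (\<phi> x * F x)) + - (LINT x|lborel. F' x * (\<phi> x * G x)) + 0"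
      by (rule tendsto_unique[OF _ difference_quotient_tendsto_partial_deriv[OF \<phi> b bFG] lim]) simp
    also have "\<dots> = - (LINT x|lborel. (F x * G' x) * \<phi> x + (F' x * G x) * \<phi> x)"
      using Cc_integrable[OF bounded_borel_mult[OF bb(1,4)] Cc] Cc_integrable[OF bounded_borel_mult[OF bb(2,3)] Cc]
      by (simp add: mult_ac)
    also have "\<dots> = - (LINT x|lborel. (F x * G' x + F' x * G x) * \<phi> x)"
      by (simp only: distrib_right)
    finally show ?thesis .
  qed
  then show ?thesis
    unfolding weak_deriv_lborel_def
    by (intro conjI ballI bounded_borel_add bounded_borel_mult bb)
qed

section \<open>The algebra of bounded functions with bounded weak derivatives\<close>

text \<open>The integral of a partial derivative of a test function is zero, being the limit of
  integrals of difference quotients, which vanish by translation invariance.\<close>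

lemma weak_deriv_lborel_const:
  fixes \<Omega> :: "'a::euclidean_space set"
  assumes "b \<in> Basis"
  shows "weak_deriv_lborel \<Omega> b (\<lambda>x. c) (\<lambda>x. 0)"
proof -
  have "(LINT x|lborel. c * partial_deriv b \<phi> x) = 0" if \<phi>: "\<phi> \<in> test_functions \<Omega>" for \<phi>
  proof -
    have "\<phi> \<in> test_functions UNIV"
      using \<phi> by (simp add: test_functions_def)
    then have "(\<lambda>x. \<phi> (x + t *\<^sub>R b)) \<in> test_functions UNIV" for t
      by (rule test_function_shift) simp
    then have "(\<lambda>x. \<phi> (x + t *\<^sub>R b)) \<in> Cc" for t
      by (rule test_function_Cc)
    from integral_difference_quotient_shift[OF bounded_borel_const[of c] test_function_Cc(1)[OF \<phi>] this]
    have "(LINT x|lborel. c * ((\<phi> (x + t *\<^sub>R b) - \<phi> x) / t)) = 0" for t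
      by simp
    then have "((\<lambda>t. 0) \<longlongrightarrow> (LINT x|lborel. c * partial_deriv b \<phi> x)) (at (0::real))"
      using difference_quotient_tendsto_partial_deriv[OF \<phi> assms bounded_borel_const[of c]] by (simp only:)
    then show ?thesis
      by (simp add: tendsto_const_iff)
  qed
  then show ?thesis
    by (simp add: weak_deriv_lborel_def bounded_borel_const)
qed

lemma weak_deriv_lborel_add:
  assumes b: "b \<in> Basis"
    and F: "weak_deriv_lborel \<Omega> b F F'" and G: "weak_deriv_lborel \<Omega> b G G'"
  shows "weak_deriv_lborel \<Omega> b (\<lambda>x. F x + G x) (\<lambda>x. F' x + G' x)"
proof -
  have bb: "bounded_borel F" "bounded_borel F'" "bounded_borel G" "bounded_borel G'"
    using F G by (auto simp: weak_deriv_lborel_def)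
  have "(LINT x|lborel. (F x + G x) * partial_deriv b \<phi> x) = - (LINT x|lborel. (F' x + G' x) * \<phi> x)"
    if \<phi>: "\<phi> \<in> test_functions \<Omega>" for \<phi>
  proof -
    note Cc = test_function_Cc(1)[OF \<phi>] and Cc' = test_function_Cc(2)[OF \<phi> b]
    have "(LINT x|lborel. F x * partial_deriv b \<phi> x) = - (LINT x|lborel. F' x * \<phi> x)"
        "(LINT x|lborel. G x * partial_deriv b \<phi> x) = - (LINT x|lborel. G' x * \<phi> x)"
      using F G \<phi> by (simp_all add: weak_deriv_lborel_def)
    then show ?thesis
      unfolding distrib_right
      by (simp only: Bochner_Integration.integral_add[OF Cc_integrable[OF bb(1) Cc'] Cc_integrable[OF bb(3) Cc']]
          Bochner_Integration.integral_add[OF Cc_integrable[OF bb(2) Cc] Cc_integrable[OF bb(4) Cc]]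
          minus_add_distrib)
  qed
  then show ?thesis
    unfolding weak_deriv_lborel_def by (intro conjI ballI bounded_borel_add bb)
qed

lemma AE_lebesgue_on_iff:
  fixes \<Omega> :: "'a::euclidean_space set"
  assumes "open \<Omega>"
  shows "(AE x in lebesgue_on \<Omega>. P x) \<longleftrightarrow> (AE x in lborel. x \<in> \<Omega> \<longrightarrow> P x)"
  using assms by (simp add: AE_restrict_space_iff AE_completion_iff)

text \<open>A member of \<open>L_infty \<Omega>\<close> is only Lebesgue measurable on \<open>\<Omega>\<close> and bounded almost everywhere; an
  almost everywhere equal Borel function can be cut off at the essential bound.\<close>

lemma L_infty_iff_bounded_borel:
  fixes \<Omega> :: "'a::euclidean_space set"
  assumes \<Omega>: "open \<Omega>"
  shows "f \<in> L_infty \<Omega> \<longleftrightarrow> (\<exists>F. bounded_borel F \<and> (AE x in lborel. x \<in> \<Omega> \<longrightarrow> f x = F x))"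
proof
  assume "f \<in> L_infty \<Omega>"
  then obtain C where f: "f \<in> borel_measurable (lebesgue_on \<Omega>)"
    and C: "AE x in lborel. x \<in> \<Omega> \<longrightarrow> \<bar>f x\<bar> \<le> C"
    using AE_lebesgue_on_iff[OF \<Omega>] by (auto simp: L_infty_def)
  have "(\<lambda>x. if x \<in> \<Omega> then f x else 0) \<in> borel_measurable lebesgue"
    using f \<Omega> by (intro borel_measurable_if_I) auto
  then obtain g where g: "g \<in> borel_measurable lborel"
    and eq: "AE x in lborel. (if x \<in> \<Omega> then f x else 0) = g x"
    using completion_ex_borel_measurable_real by blast
  define F where "F x = (if \<bar>g x\<bar> \<le> C then g x else 0)" for x
  have [measurable]: "g \<in> borel_measurable borel"
    using g by simp
  have "bounded_borel F"
  proof (rule bounded_borelI)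
    show "F \<in> borel_measurable borel"
      unfolding F_def by measurable
    show "\<bar>F x\<bar> \<le> \<bar>C\<bar>" for x
      by (auto simp: F_def)
  qed
  moreover have "AE x in lborel. x \<in> \<Omega> \<longrightarrow> f x = F x"
    using C eq by eventually_elim (auto simp: F_def)
  ultimately show "\<exists>F. bounded_borel F \<and> (AE x in lborel. x \<in> \<Omega> \<longrightarrow> f x = F x)"
    by blast
next
  assume "\<exists>F. bounded_borel F \<and> (AE x in lborel. x \<in> \<Omega> \<longrightarrow> f x = F x)"
  then obtain F where F: "bounded_borel F" and eq: "AE x in lborel. x \<in> \<Omega> \<longrightarrow> f x = F x"
    by blast
  obtain C where C: "\<And>x. \<bar>F x\<bar> \<le> C"
    using bounded_borel_bound[OF F] by blast
  have "(\<lambda>x. if x \<in> \<Omega> then F x else 0) \<in> borel_measurable borel"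
    using bounded_borel_measurable[OF F] \<Omega> by (intro measurable_If_set) auto
  then have "(\<lambda>x. if x \<in> \<Omega> then F x else 0) \<in> borel_measurable lebesgue"
    by (intro measurable_completion) simp
  moreover have "AE x in lebesgue. (if x \<in> \<Omega> then F x else 0) = (if x \<in> \<Omega> then f x else 0)"
    by (rule AE_completion) (use eq in \<open>eventually_elim, auto\<close>)
  ultimately have "(\<lambda>x. if x \<in> \<Omega> then f x else 0) \<in> borel_measurable lebesgue"
    by (rule borel_measurable_AE)
  then have "f \<in> borel_measurable (lebesgue_on \<Omega>)"
    by (rule borel_measurable_if_D)
  moreover have "AE x in lborel. x \<in> \<Omega> \<longrightarrow> \<bar>f x\<bar> \<le> C"
    using eq by eventually_elim (use C in simp)
  ultimately show "f \<in> L_infty \<Omega>"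
    using AE_lebesgue_on_iff[OF \<Omega>] by (auto simp: L_infty_def)
qed

lemma integral_lebesgue_on_eq_lborel:
  fixes \<Omega> :: "'a::euclidean_space set"
  assumes \<Omega>: "open \<Omega>" and f: "f \<in> L_infty \<Omega>" and F: "bounded_borel F"
    and eq: "AE x in lborel. x \<in> \<Omega> \<longrightarrow> f x = F x"
    and \<psi>: "\<psi> \<in> Cc" and supp: "\<And>x. x \<notin> \<Omega> \<Longrightarrow> \<psi> x = 0"
  shows "(LINT x|lebesgue_on \<Omega>. f x * \<psi> x) = (LINT x|lborel. F x * \<psi> x)"
proof -
  have meas: "F \<in> borel_measurable (lebesgue_on \<Omega>)" "\<psi> \<in> borel_measurable (lebesgue_on \<Omega>)"
      "f \<in> borel_measurable (lebesgue_on \<Omega>)"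
    using F Cc_bounded_borel[OF \<psi>] f
    by (auto simp: L_infty_def bounded_borel_def intro!: measurable_restrict_space1 measurable_completion)
  have "(LINT x|lebesgue_on \<Omega>. f x * \<psi> x) = (LINT x|lebesgue_on \<Omega>. F x * \<psi> x)"
  proof (rule integral_cong_AE)
    show "AE x in lebesgue_on \<Omega>. f x * \<psi> x = F x * \<psi> x"
      unfolding AE_lebesgue_on_iff[OF \<Omega>] using eq by eventually_elim simp
  qed (intro borel_measurable_times meas)+
  also have "\<dots> = (LINT x|lebesgue. (if x \<in> \<Omega> then F x * \<psi> x else 0))"
    using \<Omega> by (subst Lebesgue_Measure.integral_restrict_UNIV) auto
  also have "\<dots> = (LINT x|lebesgue. F x * \<psi> x)"
    by (rule Bochner_Integration.integral_cong) (simp_all add: supp)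
  also have "\<dots> = (LINT x|lborel. F x * \<psi> x)"
    using borel_measurable_integrable[OF Cc_integrable[OF F \<psi>]] by (rule integral_completion)
  finally show ?thesis .
qed

lemma weak_partial_deriv_iff_lborel:
  fixes \<Omega> :: "'a::euclidean_space set"
  assumes \<Omega>: "open \<Omega>" and b: "b \<in> Basis"
    and F: "bounded_borel F" "AE x in lborel. x \<in> \<Omega> \<longrightarrow> f x = F x"
    and G: "bounded_borel G" "AE x in lborel. x \<in> \<Omega> \<longrightarrow> g x = G x"
  shows "weak_partial_deriv \<Omega> b f g \<longleftrightarrow> weak_deriv_lborel \<Omega> b F G"
proof -
  have L: "f \<in> L_infty \<Omega>" "g \<in> L_infty \<Omega>"
    unfolding L_infty_iff_bounded_borel[OF \<Omega>] using F G by blast+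
  have "(LINT x|lebesgue_on \<Omega>. f x * partial_deriv b \<phi> x) = (LINT x|lborel. F x * partial_deriv b \<phi> x)"
      "(LINT x|lebesgue_on \<Omega>. g x * \<phi> x) = (LINT x|lborel. G x * \<phi> x)"
    if \<phi>: "\<phi> \<in> test_functions \<Omega>" for \<phi>
  proof -
    have supp: "x \<notin> closure {x. \<phi> x \<noteq> 0}" if "x \<notin> \<Omega>" for x
      using \<phi> that by (auto simp: test_functions_def)
    have zero: "\<phi> x = 0" if "x \<notin> \<Omega>" for x
      using supp[OF that] closure_subset[of "{x. \<phi> x \<noteq> 0}"] by blast
    show "(LINT x|lebesgue_on \<Omega>. f x * partial_deriv b \<phi> x) = (LINT x|lborel. F x * partial_deriv b \<phi> x)"
      by (rule integral_lebesgue_on_eq_lborel[OF \<Omega> L(1) F test_function_Cc(2)[OF \<phi> b]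
            partial_deriv_eq_0_outside_support[OF supp]])
    show "(LINT x|lebesgue_on \<Omega>. g x * \<phi> x) = (LINT x|lborel. G x * \<phi> x)"
      by (rule integral_lebesgue_on_eq_lborel[OF \<Omega> L(2) G test_function_Cc(1)[OF \<phi>] zero])
  qed
  with F(1) G(1) show ?thesis
    by (simp add: weak_partial_deriv_def weak_deriv_lborel_def)
qed

text \<open>Membership expressed through one good representative, which serves for all directions.
  The closure properties of the space follow from those of the derivatives on this side.\<close>

lemma W1_infty_iff_weak_deriv_lborel:
  fixes \<Omega> :: "'a::euclidean_space set"
  assumes \<Omega>: "open \<Omega>"
  shows "f \<in> W1_infty \<Omega> \<longleftrightarrow> (\<exists>F. bounded_borel F \<and> (AE x in lborel. x \<in> \<Omega> \<longrightarrow> f x = F x) \<and>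
    (\<forall>b\<in>Basis. \<exists>F'. weak_deriv_lborel \<Omega> b F F'))"
proof
  assume f: "f \<in> W1_infty \<Omega>"
  then obtain F where F: "bounded_borel F" "AE x in lborel. x \<in> \<Omega> \<longrightarrow> f x = F x"
    using L_infty_iff_bounded_borel[OF \<Omega>] by (auto simp: W1_infty_def)
  have "\<exists>F'. weak_deriv_lborel \<Omega> b F F'" if b: "b \<in> Basis" for b
  proof -
    obtain g where g: "g \<in> L_infty \<Omega>" "weak_partial_deriv \<Omega> b f g"
      using f b by (auto simp: W1_infty_def)
    then obtain G where G: "bounded_borel G" "AE x in lborel. x \<in> \<Omega> \<longrightarrow> g x = G x"
      using L_infty_iff_bounded_borel[OF \<Omega>] by blast
    with g(2) show ?thesis
      using weak_partial_deriv_iff_lborel[OF \<Omega> b F G] by blast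
  qed
  with F show "\<exists>F. bounded_borel F \<and> (AE x in lborel. x \<in> \<Omega> \<longrightarrow> f x = F x) \<and>
    (\<forall>b\<in>Basis. \<exists>F'. weak_deriv_lborel \<Omega> b F F')"
    by blast
next
  assume "\<exists>F. bounded_borel F \<and> (AE x in lborel. x \<in> \<Omega> \<longrightarrow> f x = F x) \<and>
    (\<forall>b\<in>Basis. \<exists>F'. weak_deriv_lborel \<Omega> b F F')"
  then obtain F where F: "bounded_borel F" "AE x in lborel. x \<in> \<Omega> \<longrightarrow> f x = F x"
    and ex: "\<And>b. b \<in> Basis \<Longrightarrow> \<exists>F'. weak_deriv_lborel \<Omega> b F F'"
    by blast
  have "\<exists>g\<in>L_infty \<Omega>. weak_partial_deriv \<Omega> b f g" if b: "b \<in> Basis" for b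
  proof -
    obtain G where weak: "weak_deriv_lborel \<Omega> b F G"
      using ex[OF b] by blast
    then have G: "bounded_borel G"
      by (simp add: weak_deriv_lborel_def)
    then have "G \<in> L_infty \<Omega>"
      unfolding L_infty_iff_bounded_borel[OF \<Omega>] by (intro exI[of _ G]) simp
    with weak show ?thesis
      using weak_partial_deriv_iff_lborel[OF \<Omega> b F G] by (intro bexI[of _ G]) auto
  qed
  with F show "f \<in> W1_infty \<Omega>"
    using L_infty_iff_bounded_borel[OF \<Omega>] by (auto simp: W1_infty_def)
qed

lemma W1_infty_cong_AE:
  assumes \<Omega>: "open \<Omega>" and g: "g \<in> W1_infty \<Omega>" and eq: "AE x in lebesgue_on \<Omega>. f x = g x"
  shows "f \<in> W1_infty \<Omega>"
proof -
  obtain G where G: "bounded_borel G" "AE x in lborel. x \<in> \<Omega> \<longrightarrow> g x = G x"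
      "\<forall>b\<in>Basis. \<exists>G'. weak_deriv_lborel \<Omega> b G G'"
    using g unfolding W1_infty_iff_weak_deriv_lborel[OF \<Omega>] by blast
  have "AE x in lborel. x \<in> \<Omega> \<longrightarrow> f x = G x"
    using G(2) eq[unfolded AE_lebesgue_on_iff[OF \<Omega>]] by eventually_elim simp
  with G show ?thesis
    unfolding W1_infty_iff_weak_deriv_lborel[OF \<Omega>] by blast
qed

lemma W1_infty_const:
  assumes "open \<Omega>"
  shows "(\<lambda>x. c) \<in> W1_infty \<Omega>"
  unfolding W1_infty_iff_weak_deriv_lborel[OF assms]
proof (rule exI[of _ "\<lambda>x. c"], intro conjI ballI)
  show "\<exists>F'. weak_deriv_lborel \<Omega> b (\<lambda>x. c) F'" if "b \<in> Basis" for b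
    by (intro exI[of _ "\<lambda>x. 0"] weak_deriv_lborel_const that)
qed (simp_all add: bounded_borel_const)

lemma W1_infty_add:
  assumes \<Omega>: "open \<Omega>" and "f \<in> W1_infty \<Omega>" "g \<in> W1_infty \<Omega>"
  shows "(\<lambda>x. f x + g x) \<in> W1_infty \<Omega>"
proof -
  obtain F G where F: "bounded_borel F" "AE x in lborel. x \<in> \<Omega> \<longrightarrow> f x = F x"
      "\<And>b. b \<in> Basis \<Longrightarrow> \<exists>F'. weak_deriv_lborel \<Omega> b F F'"
    and G: "bounded_borel G" "AE x in lborel. x \<in> \<Omega> \<longrightarrow> g x = G x"
      "\<And>b. b \<in> Basis \<Longrightarrow> \<exists>G'. weak_deriv_lborel \<Omega> b G G'"
    using assms(2,3) unfolding W1_infty_iff_weak_deriv_lborel[OF \<Omega>] by blast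
  have "AE x in lborel. x \<in> \<Omega> \<longrightarrow> f x + g x = F x + G x"
    using F(2) G(2) by eventually_elim simp
  moreover have "\<exists>H. weak_deriv_lborel \<Omega> b (\<lambda>x. F x + G x) H" if "b \<in> Basis" for b
    using F(3)[OF that] G(3)[OF that] weak_deriv_lborel_add[OF that] by blast
  ultimately show ?thesis
    unfolding W1_infty_iff_weak_deriv_lborel[OF \<Omega>]
    using bounded_borel_add[OF F(1) G(1)] by blast
qed

theorem W1_infty_mult:
  assumes \<Omega>: "open \<Omega>" and "f \<in> W1_infty \<Omega>" "g \<in> W1_infty \<Omega>"
  shows "(\<lambda>x. f x * g x) \<in> W1_infty \<Omega>"
proof -
  obtain F G where F: "bounded_borel F" "AE x in lborel. x \<in> \<Omega> \<longrightarrow> f x = F x"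
      "\<And>b. b \<in> Basis \<Longrightarrow> \<exists>F'. weak_deriv_lborel \<Omega> b F F'"
    and G: "bounded_borel G" "AE x in lborel. x \<in> \<Omega> \<longrightarrow> g x = G x"
      "\<And>b. b \<in> Basis \<Longrightarrow> \<exists>G'. weak_deriv_lborel \<Omega> b G G'"
    using assms(2,3) unfolding W1_infty_iff_weak_deriv_lborel[OF \<Omega>] by blast
  have "AE x in lborel. x \<in> \<Omega> \<longrightarrow> f x * g x = F x * G x"
    using F(2) G(2) by eventually_elim simp
  moreover have "\<exists>H. weak_deriv_lborel \<Omega> b (\<lambda>x. F x * G x) H" if "b \<in> Basis" for b
    using F(3)[OF that] G(3)[OF that] weak_deriv_lborel_mult[OF that \<Omega>] by blast
  ultimately show ?thesis
    unfolding W1_infty_iff_weak_deriv_lborel[OF \<Omega>]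
    using bounded_borel_mult[OF F(1) G(1)] by blast
qed

lemma W1_infty_sum:
  assumes "open \<Omega>" "finite I" "\<And>i. i \<in> I \<Longrightarrow> f i \<in> W1_infty \<Omega>"
  shows "(\<lambda>x. \<Sum>i\<in>I. f i x) \<in> W1_infty \<Omega>"
  using assms(2,3) by (induction I rule: finite_induct) (auto intro: W1_infty_const W1_infty_add assms(1))

lemma W1_infty_prod:
  assumes "open \<Omega>" "finite I" "\<And>i. i \<in> I \<Longrightarrow> f i \<in> W1_infty \<Omega>"
  shows "(\<lambda>x. \<Prod>i\<in>I. f i x) \<in> W1_infty \<Omega>"
  using assms(2,3) by (induction I rule: finite_induct) (auto intro: W1_infty_const W1_infty_mult assms(1))

section \<open>Determinants and inverses of matrix fields\<close>

lemma W1_infty_det: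
  fixes A :: "'a::euclidean_space \<Rightarrow> real^'n^'n"
  assumes "open \<Omega>" "A \<in> W1_infty_mat \<Omega>"
  shows "(\<lambda>x. det (A x)) \<in> W1_infty \<Omega>"
  unfolding det_def using assms
  by (intro W1_infty_sum W1_infty_mult W1_infty_const W1_infty_prod finite_permutations)
    (auto simp: W1_infty_mat_def)

text \<open>Cramer's rule for the \<open>j\<close>-th column of the inverse, which solves \<open>A *v x = axis j 1\<close>. No division
  occurs because the determinant is one: the entries are polynomials in the entries of \<open>A\<close>.\<close>

lemma matrix_inv_entry_eq_det:
  fixes A :: "real^'n^'n"
  assumes "det A = 1"
  shows "matrix_inv A $ k $ j = det (\<chi> i l. if l = k then axis j 1 $ i else A $ i $ l)"
proof -
  have "invertible A"
    using assms by (simp add: invertible_det_nz)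
  then have "A ** matrix_inv A = mat 1"
    unfolding invertible_def matrix_inv_def by (rule someI2_ex) simp
  then have col: "A *v (matrix_inv A *v axis j 1) = axis j 1"
    by (simp add: matrix_vector_mul_assoc)
  have entry: "(matrix_inv A *v axis j 1) $ k = matrix_inv A $ k $ j"
    by (simp add: matrix_vector_mult_basis column_def)
  show ?thesis
    using cramer_lemma[of k A "matrix_inv A *v axis j 1"]
    by (simp only: col entry assms mult_1_right)
qed

text \<open>The formula for the entries holds only where the determinant is one, hence almost
  everywhere, which suffices for membership in the space.\<close>

lemma W1_infty_mat_matrix_inv:
  fixes B :: "'a::euclidean_space \<Rightarrow> real^'n^'n"
  assumes \<Omega>: "open \<Omega>" and B: "B \<in> W1_infty_mat \<Omega>" and det: "AE x in lebesgue_on \<Omega>. det (B x) = 1"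
  shows "(\<lambda>x. matrix_inv (B x)) \<in> W1_infty_mat \<Omega>"
  unfolding W1_infty_mat_def
proof (intro CollectI allI)
  fix k j :: 'n
  let ?C = "\<lambda>x. \<chi> i l. if l = k then axis j 1 $ i else B x $ i $ l"
  have "(\<lambda>x. ?C x $ i $ l) \<in> W1_infty \<Omega>" for i l
    using B W1_infty_const[OF \<Omega>] by (cases "l = k") (simp_all add: W1_infty_mat_def)
  then have "?C \<in> W1_infty_mat \<Omega>"
    by (simp only: W1_infty_mat_def mem_Collect_eq simp_thms)
  then have "(\<lambda>x. det (?C x)) \<in> W1_infty \<Omega>"
    by (rule W1_infty_det[OF \<Omega>])
  moreover have "AE x in lebesgue_on \<Omega>. matrix_inv (B x) $ k $ j = det (?C x)"
    using det by eventually_elim (rule matrix_inv_entry_eq_det)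
  ultimately show "(\<lambda>x. matrix_inv (B x) $ k $ j) \<in> W1_infty \<Omega>"
    by (rule W1_infty_cong_AE[OF \<Omega>])
qed

theorem proposition5p4:
  fixes \<Omega> :: "(real^3) set" and B :: "real^3 \<Rightarrow> real^3^3"
  assumes "open \<Omega>" and "connected \<Omega>" and "\<Omega> \<noteq> {}" and "bounded \<Omega>"
    and "B \<in> W1_infty_mat \<Omega>"
    and "AE x in lebesgue_on \<Omega>. det (B x) = 1"
  shows "(\<lambda>x. matrix_inv (B x)) \<in> W1_infty_mat \<Omega> \<and>
    (\<forall>\<mu>\<^sub>1\<in>W1_infty \<Omega>. \<forall>\<mu>\<^sub>2\<in>W1_infty \<Omega>. \<forall>\<mu>\<^sub>3\<in>W1_infty \<Omega>.
       A_op \<mu>\<^sub>1 \<mu>\<^sub>2 \<mu>\<^sub>3 B \<in> W1_infty_mat \<Omega>)"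
proof (intro conjI ballI)
  show inv: "(\<lambda>x. matrix_inv (B x)) \<in> W1_infty_mat \<Omega>"
    using assms(1,5,6) by (rule W1_infty_mat_matrix_inv)
  fix \<mu>\<^sub>1 \<mu>\<^sub>2 \<mu>\<^sub>3
  assume \<mu>: "\<mu>\<^sub>1 \<in> W1_infty \<Omega>" "\<mu>\<^sub>2 \<in> W1_infty \<Omega>" "\<mu>\<^sub>3 \<in> W1_infty \<Omega>"
  have entries: "(\<lambda>x. B x $ i $ j) \<in> W1_infty \<Omega>" "(\<lambda>x. matrix_inv (B x) $ i $ j) \<in> W1_infty \<Omega>" for i j
    using assms(5) inv by (auto simp: W1_infty_mat_def)
  have "(\<lambda>x. \<mu>\<^sub>1 x * mat 1 $ i $ j + \<mu>\<^sub>2 x * B x $ i $ j + \<mu>\<^sub>3 x * matrix_inv (B x) $ i $ j) \<in> W1_infty \<Omega>" for i j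
    by (intro W1_infty_add W1_infty_mult W1_infty_const entries \<mu> assms(1))
  then show "A_op \<mu>\<^sub>1 \<mu>\<^sub>2 \<mu>\<^sub>3 B \<in> W1_infty_mat \<Omega>"
    by (simp add: W1_infty_mat_def A_op_def)
qed

end
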